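(* For all integers $m\ge2$ and $q\ge1$, the function $M_{\beta_{q,m}}$ is locally linear at Lebesgue almost every $\alpha\in[1-\langle\beta_{q,m}\rangle,1)$; that is, for Lebesgue almost every $\alpha\in[1-\langle\beta_{q,m}\rangle,1)$ there are an open interval $J\subset[0,1)$ containing $\alpha$ and real numbers $k,b$ such that $M_{\beta_{q,m}}(\alpha')=k\alpha'+b$ for all $\alpha'\in J$.
   Context: For a real number $r$, $\lfloor r\rfloor$ is its integer part and $\langle r\rangle=r-\lfloor r\rfloor$; $\lambda$ is Lebesgue measure. For integers $q\ge 1$, $m\ge 2$, $\beta_{q,m}$ is the unique real root in $(q,q+1)$ of $x^m=q x^{m-1}+q x^{m-2}+\cdots+q$. For $\beta>1$ and $\alpha\in[0,1)$, let $T_{\beta,\alpha}:[0,1]\to[0,1]$, $T_{\beta,\alpha}(x)=\beta x+\alpha-\lfloor\beta x+\alpha\rfloor$, with iterates $T_{\beta,\alpha}^n$ ($T_{\beta,\alpha}^0$ the identity). Define, for $x\in[0,1]$, $$\tilde g_{\beta,\alpha}(x)=\sum_{n\ge 0:\ x<T_{\beta,\alpha}^n(1)}\frac{1}{\beta^n}-\sum_{n\ge 0:\ x<T_{\beta,\alpha}^n(0)}\frac{1}{\beta^n},\qquad g_{\beta,\alpha}(x)=\frac{\tilde g_{\beta,\alpha}(x)}{\int_{[0,1]}\tilde g_{\beta,\alpha}\,d\lambda},$$ and $M_\beta(\alpha)=\int_{[0,1]}x\,g_{\beta,\alpha}(x)\,d\lambda(x)$. *)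

theory Defs
  imports "HOL-Analysis.Analysis"
begin

definition beta_qm :: "nat \<Rightarrow> nat \<Rightarrow> real" where
  "beta_qm q m = (THE x. x \<in> {real q<..<real q + 1} \<and> x ^ m = (\<Sum>i<m. real q * x ^ i))"

text \<open>The definite description in \<^const>\<open>beta_qm\<close> is meaningful for all admissible parameters.\<close>

lemma beta_qm_ex1:
  fixes q m :: nat
  assumes "q \<ge> 1" "m \<ge> 2"
  shows "\<exists>!x. x \<in> {real q<..<real q + 1} \<and> x ^ m = (\<Sum>i<m. real q * x ^ i)"
proof -
  define f where "f x = x ^ m - (\<Sum>i<m. real q * x ^ i)" for x :: real
  obtain k where k: "m = Suc (Suc k)"
    using assms(2) by (metis Suc_le_D numeral_2_eq_2 Suc_le_mono)
  have q0: "real q > 0" using assms(1) by simp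
  have "(\<Sum>i<k. real q * real q ^ i) \<ge> 0" "real q * real q ^ k > 0"
    using q0 by (auto intro: sum_nonneg)
  then have "f (real q) < 0" by (simp add: f_def k)
  moreover have "(\<Sum>i<m. real q * (real q + 1) ^ i) = (real q + 1) ^ m - 1"
    using q0 by (simp add: sum_distrib_left[symmetric] geometric_sum)
  then have "f (real q + 1) > 0" by (simp add: f_def)
  moreover have "continuous_on {real q..real q + 1} f"
    unfolding f_def by (intro continuous_intros)
  ultimately obtain x where x: "real q \<le> x" "x \<le> real q + 1" "f x = 0"
    using IVT'[of f "real q" 0 "real q + 1"] by auto
  have ne: "x \<noteq> real q" "x \<noteq> real q + 1"
    using x(3) \<open>f (real q) < 0\<close> \<open>f (real q + 1) > 0\<close> by auto
  have less: False
    if uv: "real q < u" "u < v" "f u = 0" "f v = 0" for u v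
  proof -
    have u0: "u > 0" using q0 uv by simp
    have "u ^ m * v ^ i < v ^ m * u ^ i" if "i < m" for i
    proof -
      have "u ^ (m - i) < v ^ (m - i)"
        using uv u0 that by (intro power_strict_mono) auto
      then have "u ^ (m - i) * (u ^ i * v ^ i) < v ^ (m - i) * (u ^ i * v ^ i)"
        using u0 uv by (intro mult_strict_right_mono) auto
      moreover have "u ^ m = u ^ (m - i) * u ^ i" "v ^ m = v ^ (m - i) * v ^ i"
        using that by (simp_all flip: power_add)
      ultimately show ?thesis by (simp add: mult_ac)
    qed
    then have "(\<Sum>i<m. real q * (u ^ m * v ^ i)) < (\<Sum>i<m. real q * (v ^ m * u ^ i))"
      using q0 assms(2) by (intro sum_strict_mono mult_strict_left_mono) (auto simp: lessThan_empty_iff)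
    moreover have "(\<Sum>i<m. real q * (u ^ m * v ^ i)) = u ^ m * (\<Sum>i<m. real q * v ^ i)"
      "(\<Sum>i<m. real q * (v ^ m * u ^ i)) = v ^ m * (\<Sum>i<m. real q * u ^ i)"
      by (simp_all add: sum_distrib_left mult_ac)
    ultimately show False
      using uv by (simp add: f_def mult_ac)
  qed
  show ?thesis
  proof (rule ex1I[of _ x])
    show "x \<in> {real q<..<real q + 1} \<and> x ^ m = (\<Sum>i<m. real q * x ^ i)"
      using x ne by (auto simp: f_def)
  next
    fix y assume "y \<in> {real q<..<real q + 1} \<and> y ^ m = (\<Sum>i<m. real q * y ^ i)"
    then show "y = x"
      using less[of x y] less[of y x] x ne by (force simp: f_def)
  qed
qed

text \<open>The maps and functions below are meant on \<open>[0, 1]\<close>; as total functions they are given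
  by the same formulas outside.\<close>

definition T_map :: "real \<Rightarrow> real \<Rightarrow> real \<Rightarrow> real" where
  "T_map \<beta> \<alpha> x = frac (\<beta> * x + \<alpha>)"

definition g_tilde :: "real \<Rightarrow> real \<Rightarrow> real \<Rightarrow> real" where
  "g_tilde \<beta> \<alpha> x =
     (\<Sum>\<^sub>\<infinity>n\<in>{n. x < (T_map \<beta> \<alpha> ^^ n) 1}. 1 / \<beta> ^ n) -
     (\<Sum>\<^sub>\<infinity>n\<in>{n. x < (T_map \<beta> \<alpha> ^^ n) 0}. 1 / \<beta> ^ n)"

definition g_dens :: "real \<Rightarrow> real \<Rightarrow> real \<Rightarrow> real" where
  "g_dens \<beta> \<alpha> x = g_tilde \<beta> \<alpha> x / (LINT y:{0..1}|lebesgue. g_tilde \<beta> \<alpha> y)"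

definition M_fun :: "real \<Rightarrow> real \<Rightarrow> real" where
  "M_fun \<beta> \<alpha> = (LINT x:{0..1}|lebesgue. x * g_dens \<beta> \<alpha> x)"

definition locally_linear_at :: "(real \<Rightarrow> real) \<Rightarrow> real \<Rightarrow> bool" where
  "locally_linear_at F \<alpha> \<longleftrightarrow>
     (\<exists>c d k b. \<alpha> \<in> {c<..<d} \<and> {c<..<d} \<subseteq> {0..<1} \<and> (\<forall>\<alpha>'\<in>{c<..<d}. F \<alpha>' = k * \<alpha>' + b))"

end

theory Submission
  imports Defs
begin

text \<open>Write \<open>T\<close> for \<open>T_map \<beta> \<alpha>\<close>. The whole statement rests on matching: if \<open>T^N 0 = T^N 1\<close> for
  some \<open>N\<close>, then the two series that define \<^const>\<open>g_tilde\<close> agree from the term \<open>N\<close> on. Unless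
  \<open>\<alpha>\<close> lies in a countable set, the first \<open>N\<close> points of the orbits of \<open>0\<close> and \<open>1\<close> are locally affine
  in \<open>\<alpha>\<close>, and the two points of time \<open>n\<close> move with the same speed. Hence the differences
  \<open>T^n 1 - T^n 0\<close> are locally constant, the integral of \<^const>\<open>g_tilde\<close> is locally constant, and the
  first moment, a combination of differences of squares, is locally affine
  (\<open>matching_imp_locally_linear\<close>). It remains to show that matching happens for almost every \<open>\<alpha>\<close>.

  The arithmetic of \<open>\<beta>\<close> enters through one property. Since \<open>1\<close> is the sum of the numbers
  \<open>q / \<beta>^j\<close> with \<open>1 \<le> j \<le> m\<close>, the differences of two orbits that start at \<open>0\<close> and \<open>1\<close> always
  are subset sums of these numbers, up to sign. So there is a finite set \<open>D\<close> that contains \<open>1\<close> and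
  with each \<open>d\<close> all numbers of the form \<open>\<beta> d - k\<close>, \<open>k\<close> an integer, in \<open>(-1, 1)\<close>. Matching
  almost everywhere is a consequence of this finiteness (locale \<open>finite_differences\<close>).

  Call a set \<open>Z\<close> of points in \<open>[0, 1]\<close> admissible if it contains \<open>0\<close> and \<open>1\<close> and all its differences
  lie in \<open>D\<close>, and consider the parameters for which the points of \<open>Z\<close> keep distinct orbits forever.
  For \<open>Z = {0, 1}\<close> these are the parameters without matching. By downward induction on the
  cardinality of \<open>Z\<close>, which is at most that of \<open>D\<close>, this set of parameters is null
  (\<open>unmerged_negligible\<close>). Take such an \<open>\<alpha>\<close> outside the null sets that belong to larger \<open>Z'\<close>.

  \<^item> For almost every \<open>\<alpha>\<close> there are infinitely many \<open>n\<close> for which \<open>\<alpha>\<close> lies in a parameter interval of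
    length comparable to \<open>\<beta>^-n\<close> on which the first \<open>n\<close> points of all orbits from \<open>Z\<close> avoid the
    jumps of the map (\<open>almost_all_infinitely_often_wide\<close>). There \<open>T^n\<close> moves \<open>Z\<close> to a
    configuration of fixed shape, and as the parameter runs through the interval this configuration is
    translated over a distance bounded from below. Only finitely many shapes exist.

  \<^item> If one of the translates of such a configuration merges two of its points under \<open>T\<close>, then
    so do all nearby translates for all nearby parameters. In infinitely many of the intervals this
    removes a subinterval of a fixed proportion: the set is porous at \<open>\<alpha>\<close>. A set that is porous at
    each of its points is null (\<open>sigma_porous_negligible\<close>).

  \<^item> If no translate merges, iterate the family of translates until for the first time one of
    its points crosses a jump. On one side of the crossing the image of this point is close to \<open>0\<close>, on
    the other side it is close to \<open>1\<close>, while the other points \<open>y\<close> move continuously. As neither side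
    merges, the points \<open>y\<close> stay apart from each other, from \<open>0\<close> and from \<open>1\<close>; and \<open>0\<close> and \<open>1\<close> stay
    apart because they belong to \<open>Z\<close>. So \<open>0\<close>, \<open>1\<close> and the points \<open>y\<close> form a larger admissible set
    whose points keep distinct orbits, contrary to the choice of \<open>\<alpha>\<close> (\<open>larger_unmerged_set\<close>).\<close>

section \<open>Orbits as functions of parameter and starting point\<close>

lemma frac_add_small:
  fixes v e :: real
  assumes "0 < frac v + e" "frac v + e < 1"
  shows "frac (v + e) = frac v + e" "v + e \<notin> \<int>"
proof -
  have "v - frac v \<in> \<int>" by (simp add: frac_def)
  then show "frac (v + e) = frac v + e" using assms by (subst frac_unique_iff) auto
  then show "v + e \<notin> \<int>" using assms(1) frac_eq_0_iff[of "v + e"] by auto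
qed

lemma floor_constant_on_connected:
  fixes A :: "real set"
  assumes "connected A" "A \<inter> \<int> = {}" "a \<in> A" "b \<in> A"
  shows "\<lfloor>a\<rfloor> = \<lfloor>b\<rfloor>"
proof -
  have *: False if "a \<in> A" "b \<in> A" "\<lfloor>a\<rfloor> < \<lfloor>b\<rfloor>" for a b
  proof -
    have "a \<le> of_int \<lfloor>b\<rfloor>" "of_int \<lfloor>b\<rfloor> \<le> b" using that(3) by linarith+
    then have "of_int \<lfloor>b\<rfloor> \<in> A" using connectedD_interval[OF assms(1) that(1,2)] by blast
    then show False using assms(2) by auto
  qed
  then show ?thesis using assms(3,4) by (metis linorder_neqE)
qed

locale expanding_beta =
  fixes \<beta> :: real
  assumes beta: "1 < \<beta>"
begin

abbreviation T :: "real \<Rightarrow> real \<Rightarrow> real" where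
  "T \<equiv> T_map \<beta>"

text \<open>The derivative of the \<open>n\<close>-th point of an orbit with respect to the parameter, wherever it exists; it
  does not depend on the starting point.\<close>

definition slope :: "nat \<Rightarrow> real" where
  "slope n = (\<Sum>i<n. \<beta> ^ i)"

text \<open>The \<open>n\<close>-th point of the orbit is a jump of the map, with value and right limit \<open>0\<close> and left
  limit \<open>1\<close>.\<close>

definition hits :: "real \<Rightarrow> real \<Rightarrow> nat \<Rightarrow> bool" where
  "hits \<alpha> x n \<longleftrightarrow> \<beta> * (T \<alpha> ^^ n) x + \<alpha> \<in> \<int>"

lemma slope_0 [simp]: "slope 0 = 0"
  by (simp add: slope_def)

lemma slope_Suc: "slope (Suc n) = \<beta> * slope n + 1"
  by (simp add: slope_def sum.lessThan_Suc_shift sum_distrib_left del: sum.lessThan_Suc)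

lemma slope_nonneg [simp]: "0 \<le> slope n"
  using beta by (auto simp: slope_def intro!: sum_nonneg)

lemma slope_mono: "m \<le> n \<Longrightarrow> slope m \<le> slope n"
  using beta unfolding slope_def by (intro sum_mono2) auto

lemma slope_upper: "slope n \<le> \<beta> ^ n / (\<beta> - 1)"
  using beta by (simp add: slope_def geometric_sum divide_right_mono)

lemma slope_lower: "n \<noteq> 0 \<Longrightarrow> \<beta> ^ n / \<beta> \<le> slope n"
  using beta by (cases n) (auto simp: slope_def intro!: sum_nonneg)

lemma slope_pos: "n \<noteq> 0 \<Longrightarrow> 0 < slope n"
  using slope_lower[of n] beta by (smt (verit) divide_pos_pos zero_less_power)

lemma T_range: "0 \<le> T \<alpha> x" "T \<alpha> x < 1"
  by (simp_all add: T_map_def frac_lt_1)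

lemma orbit_Suc: "(T \<alpha> ^^ Suc n) x = frac (\<beta> * (T \<alpha> ^^ n) x + \<alpha>)"
  by (simp add: T_map_def)

lemma orbit_range:
  assumes "0 \<le> x" "x \<le> 1"
  shows "0 \<le> (T \<alpha> ^^ n) x" "(T \<alpha> ^^ n) x \<le> 1"
  using assms by (cases n; simp add: T_range less_imp_le)+

lemma orbit_add: "(T \<alpha> ^^ (m + n)) x = (T \<alpha> ^^ m) ((T \<alpha> ^^ n) x)"
  by (simp add: funpow_add)

lemma orbit_merge:
  assumes "(T \<alpha> ^^ m) x = (T \<alpha> ^^ m) y" "m \<le> n"
  shows "(T \<alpha> ^^ n) x = (T \<alpha> ^^ n) y"
  using orbit_add[of "n - m" m \<alpha> x] orbit_add[of "n - m" m \<alpha> y] assms by simp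

lemma hits_add: "hits \<alpha> x (m + n) \<longleftrightarrow> hits \<alpha> ((T \<alpha> ^^ n) x) m"
  by (simp add: hits_def orbit_add)

text \<open>Unfolding the floors shows that an orbit point is affine in starting point and parameter up to an
  error that takes only countably many values. This makes jumps a countable phenomenon.\<close>

lemma orbit_polynomial_form:
  "\<exists>K. countable K \<and> (\<forall>\<alpha> x. \<exists>c\<in>K. (T \<alpha> ^^ n) x = \<beta> ^ n * x + slope n * \<alpha> - c)"
proof (induction n)
  case 0
  show ?case by (intro exI[of _ "{0}"]) auto
next
  case (Suc n)
  then obtain K where K: "countable K"
    "\<And>\<alpha> x. \<exists>c\<in>K. (T \<alpha> ^^ n) x = \<beta> ^ n * x + slope n * \<alpha> - c" by blast
  let ?K = "(\<lambda>(c, k :: int). \<beta> * c + of_int k) ` (K \<times> UNIV)"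
  have "\<exists>c\<in>?K. (T \<alpha> ^^ Suc n) x = \<beta> ^ Suc n * x + slope (Suc n) * \<alpha> - c" for \<alpha> x
  proof -
    obtain c where c: "c \<in> K" "(T \<alpha> ^^ n) x = \<beta> ^ n * x + slope n * \<alpha> - c" using K(2) by blast
    let ?k = "\<lfloor>\<beta> * (T \<alpha> ^^ n) x + \<alpha>\<rfloor>"
    have "(T \<alpha> ^^ Suc n) x = \<beta> * (T \<alpha> ^^ n) x + \<alpha> - ?k"
      by (simp add: T_map_def frac_def)
    then have "(T \<alpha> ^^ Suc n) x = \<beta> ^ Suc n * x + slope (Suc n) * \<alpha> - (\<beta> * c + of_int ?k)"
      by (simp add: c(2) slope_Suc algebra_simps)
    moreover have "\<beta> * c + of_int ?k \<in> ?K" using c(1) by force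
    ultimately show ?thesis by blast
  qed
  moreover have "countable ?K" using K(1) by auto
  ultimately show ?case by blast
qed

lemma hits_countable:
  "countable {\<alpha>. hits \<alpha> x n}" "countable {x. hits \<alpha> x n}"
proof -
  obtain K where K: "countable K"
    "\<And>\<alpha> x. \<exists>c\<in>K. (T \<alpha> ^^ n) x = \<beta> ^ n * x + slope n * \<alpha> - c"
    using orbit_polynomial_form by blast
  have *: "\<exists>c\<in>K. \<exists>k::int. \<beta> ^ Suc n * x + slope (Suc n) * \<alpha> = of_int k + \<beta> * c"
    if "hits \<alpha> x n" for \<alpha> x
  proof -
    obtain c where c: "c \<in> K" "(T \<alpha> ^^ n) x = \<beta> ^ n * x + slope n * \<alpha> - c" using K(2) by blast
    obtain k :: int where "\<beta> * (T \<alpha> ^^ n) x + \<alpha> = of_int k"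
      using \<open>hits \<alpha> x n\<close> by (auto simp: hits_def elim: Ints_cases)
    then have "\<beta> ^ Suc n * x + slope (Suc n) * \<alpha> = of_int k + \<beta> * c"
      by (simp add: c(2) slope_Suc algebra_simps)
    then show ?thesis using c(1) by blast
  qed
  have s: "slope (Suc n) \<noteq> 0" "\<beta> ^ Suc n \<noteq> 0" using slope_pos[of "Suc n"] beta by auto
  have "{\<alpha>. hits \<alpha> x n} \<subseteq>
      (\<lambda>(c, k :: int). (of_int k + \<beta> * c - \<beta> ^ Suc n * x) / slope (Suc n)) ` (K \<times> UNIV)"
  proof
    fix \<alpha> assume "\<alpha> \<in> {\<alpha>. hits \<alpha> x n}"
    with * obtain c k where "c \<in> K"
      and e: "\<beta> ^ Suc n * x + slope (Suc n) * \<alpha> = of_int (k::int) + \<beta> * c" by blast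
    moreover have "\<alpha> = (of_int k + \<beta> * c - \<beta> ^ Suc n * x) / slope (Suc n)"
      unfolding e[symmetric] using s by simp
    ultimately show "\<alpha> \<in> (\<lambda>(c, k :: int). (of_int k + \<beta> * c - \<beta> ^ Suc n * x) / slope (Suc n)) ` (K \<times> UNIV)"
      by (intro image_eqI[of _ _ "(c, k)"]) auto
  qed
  then show "countable {\<alpha>. hits \<alpha> x n}" using K(1) by (auto intro: countable_subset)
  have "{x. hits \<alpha> x n} \<subseteq>
      (\<lambda>(c, k :: int). (of_int k + \<beta> * c - slope (Suc n) * \<alpha>) / \<beta> ^ Suc n) ` (K \<times> UNIV)"
  proof
    fix x assume "x \<in> {x. hits \<alpha> x n}"
    with * obtain c k where "c \<in> K"
      and e: "\<beta> ^ Suc n * x + slope (Suc n) * \<alpha> = of_int (k::int) + \<beta> * c" by blast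
    moreover have "x = (of_int k + \<beta> * c - slope (Suc n) * \<alpha>) / \<beta> ^ Suc n"
      unfolding e[symmetric] using s by simp
    ultimately show "x \<in> (\<lambda>(c, k :: int). (of_int k + \<beta> * c - slope (Suc n) * \<alpha>) / \<beta> ^ Suc n) ` (K \<times> UNIV)"
      by (intro image_eqI[of _ _ "(c, k)"]) auto
  qed
  then show "countable {x. hits \<alpha> x n}" using K(1) by (auto intro: countable_subset)
qed

text \<open>As long as an orbit avoids the jumps, a small change of starting point and parameter does not alter
  the floors, and the orbit moves affinely.\<close>

lemma orbit_affine_near:
  assumes "\<And>j. j < n \<Longrightarrow> \<not> hits \<alpha>\<^sub>0 x\<^sub>0 j"
  shows "\<exists>r>0. \<forall>\<alpha> x. \<bar>\<alpha> - \<alpha>\<^sub>0\<bar> < r \<longrightarrow> \<bar>x - x\<^sub>0\<bar> < r \<longrightarrow>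
    (\<forall>j\<le>n. (T \<alpha> ^^ j) x = (T \<alpha>\<^sub>0 ^^ j) x\<^sub>0 + \<beta> ^ j * (x - x\<^sub>0) + slope j * (\<alpha> - \<alpha>\<^sub>0)) \<and>
    (\<forall>j<n. \<not> hits \<alpha> x j)"
  using assms
proof (induction n)
  case 0
  show ?case by (intro exI[of _ 1]) auto
next
  case (Suc n)
  then obtain r where r: "r > 0" and IH: "\<And>\<alpha> x j. \<bar>\<alpha> - \<alpha>\<^sub>0\<bar> < r \<Longrightarrow> \<bar>x - x\<^sub>0\<bar> < r \<Longrightarrow> j \<le> n \<Longrightarrow>
      (T \<alpha> ^^ j) x = (T \<alpha>\<^sub>0 ^^ j) x\<^sub>0 + \<beta> ^ j * (x - x\<^sub>0) + slope j * (\<alpha> - \<alpha>\<^sub>0)"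
    "\<And>\<alpha> x j. \<bar>\<alpha> - \<alpha>\<^sub>0\<bar> < r \<Longrightarrow> \<bar>x - x\<^sub>0\<bar> < r \<Longrightarrow> j < n \<Longrightarrow> \<not> hits \<alpha> x j"
    by (metis less_Suc_eq)
  define v where "v = \<beta> * (T \<alpha>\<^sub>0 ^^ n) x\<^sub>0 + \<alpha>\<^sub>0"
  \<comment> \<open>The Lipschitz constant of the argument of \<open>frac\<close> in the last step, with respect to both variables.\<close>
  define C where "C = \<beta> ^ Suc n + slope (Suc n)"
  have C: "C > 0" using beta slope_nonneg[of "Suc n"] unfolding C_def
    by (meson add_pos_nonneg less_trans zero_less_one zero_less_power)
  have v: "0 < frac v" "frac v < 1"
    using Suc.prems[of n] frac_eq_0_iff[of v] frac_ge_0[of v] frac_lt_1[of v]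
    by (auto simp: hits_def v_def less_le)
  define r' where "r' = min r (min (frac v) (1 - frac v) / C)"
  have r': "r' > 0" "r' \<le> r" using r C v by (auto simp: r'_def)
  have "r' \<le> min (frac v) (1 - frac v) / C" by (simp add: r'_def)
  then have r'C: "r' * C \<le> min (frac v) (1 - frac v)" using C by (simp only: pos_le_divide_eq)
  show ?case
  proof (intro exI[of _ r'] conjI r'(1) allI impI)
    fix \<alpha> x assume a: "\<bar>\<alpha> - \<alpha>\<^sub>0\<bar> < r'" "\<bar>x - x\<^sub>0\<bar> < r'"
    define e where "e = \<beta> ^ Suc n * (x - x\<^sub>0) + slope (Suc n) * (\<alpha> - \<alpha>\<^sub>0)"
    have "(T \<alpha> ^^ n) x = (T \<alpha>\<^sub>0 ^^ n) x\<^sub>0 + \<beta> ^ n * (x - x\<^sub>0) + slope n * (\<alpha> - \<alpha>\<^sub>0)"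
      using IH(1)[of \<alpha> x n] a r'(2) by simp
    then have w: "\<beta> * (T \<alpha> ^^ n) x + \<alpha> = v + e"
      unfolding v_def e_def by (simp only:) (simp add: slope_Suc algebra_simps)
    have "\<bar>e\<bar> \<le> \<beta> ^ Suc n * \<bar>x - x\<^sub>0\<bar> + slope (Suc n) * \<bar>\<alpha> - \<alpha>\<^sub>0\<bar>"
      unfolding e_def using beta by (intro order.trans[OF abs_triangle_ineq]) (simp add: abs_mult)
    also have "\<dots> < \<beta> ^ Suc n * r' + slope (Suc n) * r'"
      using a beta by (intro add_less_le_mono mult_strict_left_mono mult_left_mono) auto
    also have "\<dots> = r' * C" by (simp add: C_def algebra_simps)
    finally have e: "0 < frac v + e" "frac v + e < 1" using r'C by auto
    note fa = frac_add_small[OF e]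
    have step: "(T \<alpha> ^^ Suc n) x = (T \<alpha>\<^sub>0 ^^ Suc n) x\<^sub>0 + e"
      using fa(1) by (simp add: T_map_def w flip: v_def)
    show "(T \<alpha> ^^ j) x = (T \<alpha>\<^sub>0 ^^ j) x\<^sub>0 + \<beta> ^ j * (x - x\<^sub>0) + slope j * (\<alpha> - \<alpha>\<^sub>0)" if "j \<le> Suc n" for j
    proof (cases "j = Suc n")
      case True
      then show ?thesis using step by (simp add: e_def)
    next
      case False
      then show ?thesis using IH(1)[of \<alpha> x j] a r'(2) that by auto
    qed
    show "\<not> hits \<alpha> x j" if "j < Suc n" for j
    proof (cases "j = n")
      case True
      then show ?thesis using fa(2) by (simp add: hits_def w)
    next
      case False
      then show ?thesis using IH(2)[of \<alpha> x j] a r'(2) that by auto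
    qed
  qed
qed

text \<open>The global form of the preceding lemma: on a connected set of parameters and starting points without
  jumps, the argument of \<open>frac\<close> is continuous and misses the integers, so its floor is constant.\<close>

lemma orbit_affine_on_connected:
  assumes P: "connected P" and nh: "\<And>\<alpha> x j. (\<alpha>, x) \<in> P \<Longrightarrow> j < n \<Longrightarrow> \<not> hits \<alpha> x j"
    and p: "(\<alpha>, x) \<in> P" "(\<alpha>', x') \<in> P"
  shows "(T \<alpha>' ^^ n) x' = (T \<alpha> ^^ n) x + \<beta> ^ n * (x' - x) + slope n * (\<alpha>' - \<alpha>)"
  using p nh
proof (induction n arbitrary: \<alpha> x \<alpha>' x')
  case 0
  then show ?case by simp
next
  case (Suc n)
  define v where "v = (\<lambda>(\<alpha>, x). \<beta> * (T \<alpha> ^^ n) x + \<alpha>)"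
  have v: "v (a, y) = v (\<alpha>, x) + \<beta> ^ Suc n * (y - x) + slope (Suc n) * (a - \<alpha>)" if "(a, y) \<in> P" for a y
  proof -
    have "(T a ^^ n) y = (T \<alpha> ^^ n) x + \<beta> ^ n * (y - x) + slope n * (a - \<alpha>)"
      using Suc.IH[OF Suc.prems(1) that] Suc.prems(3) by simp
    then show ?thesis unfolding v_def prod.case by (simp only:) (simp add: slope_Suc algebra_simps)
  qed
  have "continuous_on P (\<lambda>p. v (\<alpha>, x) + \<beta> ^ Suc n * (snd p - x) + slope (Suc n) * (fst p - \<alpha>))"
    by (intro continuous_intros)
  then have "continuous_on P v"
    by (rule continuous_on_eq) (use v in auto)
  then have "connected (v ` P)" using P by (rule connected_continuous_image)
  moreover have "v ` P \<inter> \<int> = {}" using Suc.prems(3) by (fastforce simp: v_def hits_def)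
  ultimately have "\<lfloor>v (\<alpha>, x)\<rfloor> = \<lfloor>v (\<alpha>', x')\<rfloor>"
    using Suc.prems(1,2) by (intro floor_constant_on_connected[of "v ` P"]) auto
  moreover have "(T a ^^ Suc n) y = v (a, y) - \<lfloor>v (a, y)\<rfloor>" for a y
    by (simp only: orbit_Suc frac_def v_def prod.case)
  ultimately show ?case using v[OF Suc.prems(2)] by (simp del: funpow.simps)
qed

lemma orbit_affine_in_parameter:
  assumes "connected J" "\<And>a j. a \<in> J \<Longrightarrow> j < n \<Longrightarrow> \<not> hits a x j" "\<alpha> \<in> J" "\<alpha>' \<in> J"
  shows "(T \<alpha>' ^^ n) x = (T \<alpha> ^^ n) x + slope n * (\<alpha>' - \<alpha>)"
  using orbit_affine_on_connected[of "J \<times> {x}" n \<alpha> x \<alpha>' x] assms by (auto intro: connected_Times)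

lemma orbit_affine_in_point:
  assumes "connected I" "\<And>y j. y \<in> I \<Longrightarrow> j < n \<Longrightarrow> \<not> hits \<alpha> y j" "x \<in> I" "x' \<in> I"
  shows "(T \<alpha> ^^ n) x' = (T \<alpha> ^^ n) x + \<beta> ^ n * (x' - x)"
  using orbit_affine_on_connected[of "{\<alpha>} \<times> I" n \<alpha> x \<alpha> x'] assms by (auto intro: connected_Times)

end

section \<open>Porous sets are null\<close>

text \<open>Arbitrarily small intervals around \<open>x\<close>, not necessarily centred at \<open>x\<close>, contain an interval of
  relative size \<open>\<kappa>\<close> that misses \<open>S\<close>.\<close>

definition porous_at :: "real set \<Rightarrow> real \<Rightarrow> real \<Rightarrow> bool" where
  "porous_at S \<kappa> x \<longleftrightarrow> (\<forall>e>0. \<exists>c h c'. 0 < h \<and> h < e \<and> x \<in> ball c h \<and>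
     ball c' (\<kappa> * h) \<subseteq> ball c h \<and> S \<inter> ball c' (\<kappa> * h) = {})"

lemma measure_ball_real: "0 \<le> h \<Longrightarrow> measure lebesgue (ball (c::real) h) = 2 * h"
  by (simp add: ball_eq_greaterThanLessThan)

text \<open>By Vitali's theorem, disjoint intervals with holes, all inside \<open>U\<close>, cover almost all of \<open>S\<close>.
  Removing the holes leaves a cover that is smaller than \<open>U\<close> by the factor \<open>1 - \<kappa>\<close>.\<close>

lemma porous_cover_shrinks:
  fixes S :: "real set"
  assumes k: "0 < \<kappa>" "\<kappa> \<le> 1" and por: "\<And>x. x \<in> S \<Longrightarrow> porous_at S \<kappa> x"
    and U: "S \<subseteq> U" "open U" "U \<in> lmeasurable"
  obtains V where "S \<subseteq> V" "V \<in> lmeasurable" "measure lebesgue V \<le> (1 - \<kappa>) * measure lebesgue U"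
proof -
  define K where "K = {(c, h). 0 < h \<and> ball c h \<subseteq> U \<and>
    (\<exists>c'. ball c' (\<kappa> * h) \<subseteq> ball c h \<and> S \<inter> ball c' (\<kappa> * h) = {})}"
  have "\<exists>i. i \<in> K \<and> x \<in> ball (fst i) (snd i) \<and> snd i < d" if x: "x \<in> S" "0 < d" for x d
  proof -
    have "x \<in> U" using U(1) x(1) by blast
    then obtain r where r: "r > 0" "ball x r \<subseteq> U" using openE[OF U(2)] by blast
    have "min (r / 2) d > 0" using r x by simp
    then obtain c h c' where h: "0 < h" "h < min (r / 2) d" "x \<in> ball c h"
      "ball c' (\<kappa> * h) \<subseteq> ball c h" "S \<inter> ball c' (\<kappa> * h) = {}"
      using por[OF x(1)] unfolding porous_at_def by blast
    have "ball c h \<subseteq> ball x r" using h(2,3) by (auto simp: dist_real_def)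
    then have "(c, h) \<in> K" using h r unfolding K_def by blast
    then show ?thesis using h by (intro exI[of _ "(c, h)"]) auto
  qed
  then obtain C where C: "countable C" "C \<subseteq> K"
    and disj: "pairwise (\<lambda>i j. disjnt (ball (fst i) (snd i)) (ball (fst j) (snd j))) C"
    and negl: "negligible (S - (\<Union>i\<in>C. ball (fst i) (snd i)))"
    by (rule Vitali_covering_theorem_balls[of S K fst snd]) blast
  have "\<forall>i\<in>K. \<exists>c'. ball c' (\<kappa> * snd i) \<subseteq> ball (fst i) (snd i) \<and> S \<inter> ball c' (\<kappa> * snd i) = {}"
    unfolding K_def by auto
  then obtain p where p: "\<And>i. i \<in> K \<Longrightarrow> ball (p i) (\<kappa> * snd i) \<subseteq> ball (fst i) (snd i)"
    "\<And>i. i \<in> K \<Longrightarrow> S \<inter> ball (p i) (\<kappa> * snd i) = {}"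
    by metis
  define A where "A i = ball (fst i) (snd i) - ball (p i) (\<kappa> * snd i)" for i
  have A_meas: "A i \<in> lmeasurable" for i
    unfolding A_def by (intro fmeasurable.Diff lmeasurable_ball)
  have A_le: "measure lebesgue (A i) = (1 - \<kappa>) * measure lebesgue (ball (fst i) (snd i))" if "i \<in> C" for i
  proof -
    have "i \<in> K" using that C by auto
    then have "0 < snd i" by (auto simp: K_def)
    then have "measure lebesgue (ball (p i) (\<kappa> * snd i)) = \<kappa> * measure lebesgue (ball (fst i) (snd i))"
      using k measure_ball_real[of "\<kappa> * snd i" "p i"] measure_ball_real[of "snd i" "fst i"] by simp
    moreover have "measure lebesgue (A i) =
        measure lebesgue (ball (fst i) (snd i)) - measure lebesgue (ball (p i) (\<kappa> * snd i))"
      unfolding A_def using p(1)[OF \<open>i \<in> K\<close>] by (intro measurable_measure_Diff) auto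
    ultimately show ?thesis by (simp only: algebra_simps)
  qed
  have fin: "measure lebesgue (\<Union>i\<in>I. A i) \<le> (1 - \<kappa>) * measure lebesgue U" if I: "I \<subseteq> C" "finite I" for I
  proof -
    have "measure lebesgue (\<Union>i\<in>I. A i) \<le> (\<Sum>i\<in>I. measure lebesgue (A i))"
      using A_meas by (intro measure_UNION_le I) auto
    also have "\<dots> = (1 - \<kappa>) * (\<Sum>i\<in>I. measure lebesgue (ball (fst i) (snd i)))"
      using A_le I by (auto simp: sum_distrib_left intro!: sum.cong)
    also have "(\<Sum>i\<in>I. measure lebesgue (ball (fst i) (snd i))) = measure lebesgue (\<Union>i\<in>I. ball (fst i) (snd i))"
      using disj I by (intro measure_UNION'[symmetric]) (auto intro: pairwise_subset)
    also have "\<dots> \<le> measure lebesgue U"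
      using I C U(3) by (intro measure_mono_fmeasurable) (force simp: K_def)+
    finally show ?thesis using k by (simp add: mult_left_mono)
  qed
  have m: "(\<Union>i\<in>C. A i) \<in> lmeasurable" "measure lebesgue (\<Union>i\<in>C. A i) \<le> (1 - \<kappa>) * measure lebesgue U"
    using fmeasurable_UN_bound[OF C(1) A_meas fin] measure_UN_bound[OF C(1) A_meas fin] by auto
  let ?N = "S - (\<Union>i\<in>C. ball (fst i) (snd i))"
  show thesis
  proof (rule that)
    show "S \<subseteq> (\<Union>i\<in>C. A i) \<union> ?N" using p(2) C(2) unfolding A_def by blast
    show "(\<Union>i\<in>C. A i) \<union> ?N \<in> lmeasurable"
      by (rule fmeasurable.Un[OF m(1) negligible_imp_measurable[OF negl]])
    have "measure lebesgue ((\<Union>i\<in>C. A i) \<union> ?N) = measure lebesgue (\<Union>i\<in>C. A i)"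
      using negl m(1) by (intro measure_Un_null_set) (auto simp: negligible_iff_null_sets)
    then show "measure lebesgue ((\<Union>i\<in>C. A i) \<union> ?N) \<le> (1 - \<kappa>) * measure lebesgue U" using m by simp
  qed
qed

text \<open>The infimum \<open>m\<close> of the measures of covers of \<open>S\<close> satisfies \<open>m \<le> (1 - \<kappa>) m\<close>, so it vanishes. Covers
  stand in for the measure of \<open>S\<close>, which may fail to be measurable.\<close>

lemma porous_bounded_negligible:
  fixes S :: "real set"
  assumes k: "0 < \<kappa>" "\<kappa> \<le> 1" and por: "\<And>x. x \<in> S \<Longrightarrow> porous_at S \<kappa> x" and "bounded S"
  shows "negligible S"
proof -
  let ?M = "{measure lebesgue V | V. S \<subseteq> V \<and> V \<in> lmeasurable}"
  define m where "m = Inf ?M"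
  have bdd: "bdd_below ?M" by (rule bdd_belowI[of _ 0]) auto
  obtain a where "S \<subseteq> ball 0 a" using \<open>bounded S\<close> by (meson bounded_subset_ballD)
  then have ne: "?M \<noteq> {}" using lmeasurable_ball by blast
  have m0: "0 \<le> m" unfolding m_def using ne by (intro cInf_greatest) auto
  have step: "m \<le> (1 - \<kappa>) * (m + e)" if "e > 0" for e
  proof -
    have "\<exists>y\<in>?M. y < m + e / 2" using ne bdd that unfolding m_def
      by (subst cInf_less_iff[symmetric]) auto
    then obtain V where V: "S \<subseteq> V" "V \<in> lmeasurable" "measure lebesgue V < m + e / 2" by auto
    have "0 < e / 2" using that by simp
    obtain U where U: "open U" "V \<subseteq> U" and d: "U - V \<in> lmeasurable"
      "emeasure lebesgue (U - V) < ennreal (e / 2)"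
      using sets_lebesgue_outer_open[OF fmeasurableD[OF V(2)] \<open>0 < e / 2\<close>] by blast
    have "(U - V) \<union> V \<in> lmeasurable" using d(1) V(2) by (rule fmeasurable.Un)
    moreover have "(U - V) \<union> V = U" using U(2) by blast
    ultimately have U3: "U \<in> lmeasurable" by simp
    have "measure lebesgue (U - V) < e / 2"
      using d \<open>0 < e / 2\<close> by (simp add: emeasure_eq_measure2 ennreal_less_iff)
    have "measure lebesgue U < m + e"
      using V(3) measurable_measure_Diff[OF U3 fmeasurableD[OF V(2)] U(2)]
        \<open>measure lebesgue (U - V) < e / 2\<close> by linarith
    obtain W where W: "S \<subseteq> W" "W \<in> lmeasurable" "measure lebesgue W \<le> (1 - \<kappa>) * measure lebesgue U"
      using porous_cover_shrinks[OF k por _ U(1) U3] U(2) V(1) by (metis subset_trans)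
    have "m \<le> measure lebesgue W" unfolding m_def using W bdd by (intro cInf_lower) auto
    also have "\<dots> \<le> (1 - \<kappa>) * (m + e)" using W(3) \<open>measure lebesgue U < m + e\<close> k
      by (intro order.trans[OF W(3)] mult_left_mono) auto
    finally show ?thesis .
  qed
  have "\<kappa> * m \<le> 0"
  proof (rule field_le_epsilon)
    fix e :: real assume "e > 0"
    have "(1 - \<kappa>) * e \<le> e" using k \<open>e > 0\<close> by (simp add: mult_left_le_one_le)
    then show "\<kappa> * m \<le> 0 + e" using step[OF \<open>e > 0\<close>] by (simp add: algebra_simps)
  qed
  then have "m = 0" using m0 k by (simp add: mult_le_0_iff)
  show ?thesis unfolding negligible_outer
  proof (intro allI impI)
    fix e :: real assume "e > 0"
    then have "\<exists>y\<in>?M. y < e" using ne bdd \<open>m = 0\<close> unfolding m_def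
      by (subst cInf_less_iff[symmetric]) auto
    then show "\<exists>T. S \<subseteq> T \<and> T \<in> lmeasurable \<and> measure lebesgue T < e" by auto
  qed
qed

lemma porous_at_mono: "porous_at S \<kappa> x \<Longrightarrow> S' \<subseteq> S \<Longrightarrow> 0 < \<kappa>' \<Longrightarrow> \<kappa>' \<le> \<kappa> \<Longrightarrow> porous_at S' \<kappa>' x"
  unfolding porous_at_def
proof (intro allI impI)
  fix e :: real
  assume a: "\<forall>e>0. \<exists>c h c'. 0 < h \<and> h < e \<and> x \<in> ball c h \<and>
     ball c' (\<kappa> * h) \<subseteq> ball c h \<and> S \<inter> ball c' (\<kappa> * h) = {}" "S' \<subseteq> S" "0 < \<kappa>'" "\<kappa>' \<le> \<kappa>" "e > 0"
  then obtain c h c' where h: "0 < h" "h < e" "x \<in> ball c h"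
     "ball c' (\<kappa> * h) \<subseteq> ball c h" "S \<inter> ball c' (\<kappa> * h) = {}" by blast
  have "ball c' (\<kappa>' * h) \<subseteq> ball c' (\<kappa> * h)" using a h by (intro subset_ball mult_right_mono) auto
  then show "\<exists>c h c'. 0 < h \<and> h < e \<and> x \<in> ball c h \<and>
     ball c' (\<kappa>' * h) \<subseteq> ball c h \<and> S' \<inter> ball c' (\<kappa>' * h) = {}"
    using h a(2) by (intro exI[of _ c] exI[of _ h] exI[of _ c']) auto
qed

text \<open>The porosity constant may vary from point to point: \<open>S\<close> is the countable union of its parts with a
  common lower bound for the constant.\<close>

theorem sigma_porous_negligible:
  fixes S :: "real set"
  assumes "\<And>x. x \<in> S \<Longrightarrow> \<exists>\<kappa>>0. porous_at S \<kappa> x"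
  shows "negligible S"
proof -
  define P where "P n = {x\<in>S. porous_at S (1 / Suc n) x} \<inter> ball 0 (Suc n)" for n :: nat
  have "negligible (P n)" for n
  proof (rule porous_bounded_negligible[of "1 / Suc n"])
    show "porous_at (P n) (1 / Suc n) x" if "x \<in> P n" for x
      using that porous_at_mono[of S "1 / Suc n" x "P n" "1 / Suc n"] by (auto simp: P_def)
  qed (auto simp: P_def)
  moreover have "S \<subseteq> (\<Union>n. P n)"
  proof
    fix x assume "x \<in> S"
    then obtain \<kappa> where "\<kappa> > 0" "porous_at S \<kappa> x" using assms by blast
    obtain n1 where "1 / Suc n1 < \<kappa>" using \<open>\<kappa> > 0\<close> by (metis nat_approx_posE)
    obtain n2 :: nat where "\<bar>x\<bar> < n2" using reals_Archimedean2 by blast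
    define n where "n = max n1 n2"
    have "1 / Suc n \<le> 1 / Suc n1" by (simp add: n_def frac_le)
    then have "porous_at S (1 / Suc n) x"
      using porous_at_mono[OF \<open>porous_at S \<kappa> x\<close>, of S "1 / Suc n"] \<open>1 / Suc n1 < \<kappa>\<close> by simp
    moreover have "x \<in> ball 0 (Suc n)" using \<open>\<bar>x\<bar> < n2\<close> by (simp add: n_def)
    ultimately have "x \<in> P n" using \<open>x \<in> S\<close> by (simp add: P_def)
    then show "x \<in> (\<Union>n. P n)" by blast
  qed
  ultimately show ?thesis using negligible_countable_Union[of "range P"] negligible_subset by blast
qed

text \<open>The pieces are indexed by their left end points, which gives the bound on their number.\<close>

lemma split_interval_at_finite_set:
  fixes c d :: real
  assumes "finite P"
  obtains \<J> where "finite \<J>" "card \<J> \<le> Suc (card P)" "{c<..<d} - P \<subseteq> (\<Union>(a, b)\<in>\<J>. {a<..<b})"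
    "\<And>a b. (a, b) \<in> \<J> \<Longrightarrow> {a<..<b} \<subseteq> {c<..<d} - P"
proof -
  define P' where "P' = P \<inter> {c<..<d}"
  have fin: "finite P'" using assms by (simp add: P'_def)
  define nxt where "nxt p = Min {x\<in>insert d P'. p < x}" for p
  define \<J> where "\<J> = (\<lambda>p. (p, nxt p)) ` insert c P'"
  show thesis
  proof (cases "c < d")
    case True
    show thesis
    proof (rule that[of \<J>])
      show "finite \<J>" using fin by (simp add: \<J>_def)
      have "card \<J> \<le> card (insert c P')" unfolding \<J>_def using fin by (intro card_image_le) simp
      also have "\<dots> \<le> Suc (card P')" using fin by (simp add: card_insert_if)
      also have "card P' \<le> card P" unfolding P'_def using assms by (simp add: card_mono)
      finally show "card \<J> \<le> Suc (card P)" by simp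
      show "{c<..<d} - P \<subseteq> (\<Union>(a, b)\<in>\<J>. {a<..<b})"
      proof
        fix x assume x: "x \<in> {c<..<d} - P"
        let ?L = "{y\<in>insert c P'. y < x}"
        \<comment> \<open>The piece of \<open>x\<close> starts at the last cut before \<open>x\<close>.\<close>
        define p where "p = Max ?L"
        have L: "finite ?L" "?L \<noteq> {}" using fin x by auto
        have p: "p \<in> ?L" unfolding p_def using L by (rule Max_in)
        have pmax: "y \<le> p" if "y \<in> ?L" for y unfolding p_def using L that by (simp add: Max_ge)
        have "x < nxt p"
        proof -
          have "nxt p \<in> {x\<in>insert d P'. p < x}"
            unfolding nxt_def using fin p x by (intro Min_in) auto
          then have n: "nxt p \<in> insert d P'" "p < nxt p" by blast+
          show ?thesis
          proof (rule ccontr)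
            assume "\<not> x < nxt p"
            moreover have "nxt p \<noteq> x" using n(1) x by (auto simp: P'_def)
            ultimately have "nxt p < x" by simp
            then have "nxt p \<in> ?L" using n(1) x by auto
            then show False using pmax[of "nxt p"] n(2) by simp
          qed
        qed
        then have "x \<in> {p<..<nxt p}" using p by simp
        then show "x \<in> (\<Union>(a, b)\<in>\<J>. {a<..<b})" unfolding \<J>_def using p by blast
      qed
      show "{a<..<b} \<subseteq> {c<..<d} - P" if "(a, b) \<in> \<J>" for a b
      proof
        fix x assume x: "x \<in> {a<..<b}"
        have a: "a \<in> insert c P'" and b: "b = nxt a" using that by (auto simp: \<J>_def)
        have lower: "nxt a \<le> y" if "y \<in> insert d P'" "a < y" for y
          unfolding nxt_def using fin that by (intro Min_le) auto
        have "a < d" "c \<le> a" using a True by (auto simp: P'_def)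
        then have "x < d" "c < x" using lower[of d] x b by auto
        moreover have "x \<notin> P'" using lower[of x] x b by auto
        ultimately show "x \<in> {c<..<d} - P" by (auto simp: P'_def)
      qed
    qed
  next
    case False
    then show thesis using that[of "{}"] by auto
  qed
qed

section \<open>Wide intervals without jumps\<close>

context expanding_beta
begin

definition clear :: "real set \<Rightarrow> real set \<Rightarrow> nat \<Rightarrow> bool" where
  "clear Z J n \<longleftrightarrow> (\<forall>\<alpha>\<in>J. \<forall>z\<in>Z. \<forall>j<n. \<not> hits \<alpha> z j)"

text \<open>An interval on which all orbits from \<open>Z\<close> are affine up to time \<open>n\<close> and which has the largest order
  of magnitude that such an interval can have: the orbits move by about \<open>\<eta>\<close> as the parameter
  runs through it.\<close>

definition wide :: "real set \<Rightarrow> real \<Rightarrow> real \<Rightarrow> nat \<Rightarrow> bool" where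
  "wide Z \<eta> \<alpha> n \<longleftrightarrow> (\<exists>c. \<alpha> \<in> ball c (\<eta> / \<beta> ^ n) \<and> clear Z (ball c (\<eta> / \<beta> ^ n)) n)"

text \<open>The parameters in \<open>J\<close> that are in no such interval from time \<open>n\<close> on.\<close>

definition narrow_set :: "real set \<Rightarrow> real \<Rightarrow> real set \<Rightarrow> nat \<Rightarrow> real set" where
  "narrow_set Z \<eta> J n =
     {\<alpha>\<in>J. (\<forall>z\<in>Z. \<forall>j. \<not> hits \<alpha> z j) \<and> (\<forall>m\<ge>n. \<not> wide Z \<eta> \<alpha> m)}"

lemma clear_near:
  assumes "finite Z" "\<And>z j. z \<in> Z \<Longrightarrow> j < n \<Longrightarrow> \<not> hits \<alpha> z j"
  shows "\<exists>e>0. clear Z (ball \<alpha> e) n"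
  using assms
proof (induction Z rule: finite_induct)
  case empty
  show ?case by (intro exI[of _ 1]) (simp add: clear_def)
next
  case (insert z Z)
  then obtain e1 where e1: "e1 > 0" "clear Z (ball \<alpha> e1) n" by auto
  obtain e2 where e2: "e2 > 0" "\<And>a. \<bar>a - \<alpha>\<bar> < e2 \<Longrightarrow> (\<forall>j<n. \<not> hits a z j)"
    using orbit_affine_near[of n \<alpha> z] insert.prems
    by (metis abs_zero diff_self insertCI)
  have "clear (insert z Z) (ball \<alpha> (min e1 e2)) n"
    using e1(2) e2(2) by (auto simp: clear_def dist_real_def abs_minus_commute)
  then show ?case using e1 e2 by (intro exI[of _ "min e1 e2"]) simp
qed

lemma narrow_clear_interval:
  assumes "clear Z {a<..<b} n" "\<alpha> \<in> {a<..<b}" "\<not> wide Z \<eta> \<alpha> n" "0 < \<eta>"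
  shows "b - a \<le> 2 * (\<eta> / \<beta> ^ n)"
proof (rule ccontr)
  assume *: "\<not> b - a \<le> 2 * (\<eta> / \<beta> ^ n)"
  define h where "h = \<eta> / \<beta> ^ n"
  define c where "c = max (a + h) (min (b - h) \<alpha>)"
  have h: "0 < h" using assms(4) beta by (simp add: h_def)
  have "\<alpha> \<in> ball c h" "ball c h \<subseteq> {a<..<b}"
    using * h assms(2) unfolding h_def[symmetric]
    by (auto simp: c_def dist_real_def max_def min_def)
  then have "wide Z \<eta> \<alpha> n" using assms(1)
    unfolding wide_def h_def[symmetric] clear_def by blast
  then show False using assms(3) by blast
qed

text \<open>A point that has just crossed a jump is close to \<open>0\<close> or to \<open>1\<close>, and therefore follows the orbit of
  \<open>0\<close> or \<open>1\<close> for \<open>L\<close> further steps, during which these orbits keep away from the jumps. Hence on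
  a short interval each starting point sees at most one crossing in \<open>L\<close> steps.\<close>

lemma at_most_one_hit:
  assumes r: "0 < r" "r \<le> 1"
    and ends: "\<And>\<alpha> y l. \<alpha> \<in> {a<..<b} \<Longrightarrow> \<bar>y\<bar> < r \<or> \<bar>y - 1\<bar> < r \<Longrightarrow> l < L \<Longrightarrow> \<not> hits \<alpha> y l"
    and cl: "clear {z} {a<..<b} n" and short: "slope (n + L) * (b - a) < r"
  shows "\<exists>p. {\<alpha>\<in>{a<..<b}. \<exists>i<n + L. hits \<alpha> z i} \<subseteq> {p}"
proof (cases "{\<alpha>\<in>{a<..<b}. \<exists>i<n + L. hits \<alpha> z i} = {}")
  case False
  \<comment> \<open>The first crossing anywhere in the interval; up to this time the orbit of \<open>z\<close> is affine.\<close>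
  define i where "i = (LEAST i. \<exists>\<alpha>\<in>{a<..<b}. hits \<alpha> z i)"
  from False obtain i0 \<alpha>0 where i0: "i0 < n + L" "\<alpha>0 \<in> {a<..<b}" "hits \<alpha>0 z i0" by blast
  then have ex: "\<exists>i. \<exists>\<alpha>\<in>{a<..<b}. hits \<alpha> z i" by blast
  have i: "\<exists>\<alpha>\<in>{a<..<b}. hits \<alpha> z i" unfolding i_def using ex by (rule LeastI_ex)
  then obtain p where p: "p \<in> {a<..<b}" "hits p z i" by blast
  have "i \<le> i0" unfolding i_def using i0 by (intro Least_le) blast
  then have "i < n + L" using i0 by simp
  have "n \<le> i" using cl p by (auto simp: clear_def not_less[symmetric])
  have before: "\<not> hits \<alpha> z j" if "\<alpha> \<in> {a<..<b}" "j < i" for \<alpha> j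
    using not_less_Least[of j "\<lambda>i. \<exists>\<alpha>\<in>{a<..<b}. hits \<alpha> z i"] that by (auto simp: i_def)
  have "\<not> hits \<alpha> z j" if \<alpha>: "\<alpha> \<in> {a<..<b}" "\<alpha> \<noteq> p" and j: "j < n + L" for \<alpha> j
  proof (cases "j < i")
    case False
    define v where "v = \<beta> * (T p ^^ i) z + p"
    define e where "e = slope (Suc i) * (\<alpha> - p)"
    have v: "v \<in> \<int>" using p(2) by (simp add: hits_def v_def)
    have "(T \<alpha> ^^ i) z = (T p ^^ i) z + slope i * (\<alpha> - p)"
      using before \<alpha>(1) p(1) by (intro orbit_affine_in_parameter[of "{a<..<b}"]) auto
    then have ve: "\<beta> * (T \<alpha> ^^ i) z + \<alpha> = v + e"
      unfolding v_def e_def by (simp only:) (simp add: slope_Suc algebra_simps)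
    have "\<bar>e\<bar> = slope (Suc i) * \<bar>\<alpha> - p\<bar>" by (simp add: e_def abs_mult)
    also have "\<dots> \<le> slope (n + L) * (b - a)"
      using \<alpha> p \<open>i < n + L\<close> slope_mono[of "Suc i" "n + L"] by (intro mult_mono) auto
    finally have e: "\<bar>e\<bar> < r" using short by simp
    have "e \<noteq> 0" using \<alpha>(2) slope_pos[of "Suc i"] by (simp add: e_def)
    have f: "frac (v + e) = (if e > 0 then e else 1 + e)"
      using v e r \<open>e \<noteq> 0\<close> by (subst frac_unique_iff) (auto simp: algebra_simps)
    show ?thesis
    proof (cases "j = i")
      case True
      have "frac (v + e) \<noteq> 0" using f e r \<open>e \<noteq> 0\<close> by auto
      then show ?thesis using True ve by (simp add: hits_def)
    next
      case ne: False
      define y where "y = (T \<alpha> ^^ Suc i) z"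
      have "y = frac (v + e)" unfolding y_def by (simp only: orbit_Suc ve)
      then have "\<bar>y\<bar> < r \<or> \<bar>y - 1\<bar> < r" using f e by auto
      moreover have "j - Suc i < L" using False ne j \<open>n \<le> i\<close> by simp
      ultimately have "\<not> hits \<alpha> y (j - Suc i)" using ends \<alpha>(1) by blast
      moreover have "j - Suc i + Suc i = j" using False ne by simp
      ultimately show ?thesis using hits_add[of \<alpha> z "j - Suc i" "Suc i"] by (metis y_def)
    qed
  qed (use before \<alpha> in blast)
  then show ?thesis by blast
qed blast

text \<open>Within \<open>L\<close> steps an interval falls apart into at most \<open>card Z + 1\<close> pieces. A piece that meets the
  narrow set has a length of order \<open>\<beta>^-(n + i L)\<close> after \<open>i\<close> rounds. The hypothesis on \<open>\<eta>\<close> makes such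
  pieces short enough for the preceding lemma in the next round.\<close>

lemma narrow_cover:
  assumes r: "0 < r" "r \<le> 1" and fin: "finite Z"
    and ends: "\<And>\<alpha> y l. \<alpha> \<in> W \<Longrightarrow> \<bar>y\<bar> < r \<or> \<bar>y - 1\<bar> < r \<Longrightarrow> l < L \<Longrightarrow> \<not> hits \<alpha> y l"
    and \<eta>: "0 < \<eta>" "2 * \<eta> * \<beta> ^ L / (\<beta> - 1) < r"
    and J: "{a<..<b} \<subseteq> W" "clear Z {a<..<b} n"
  shows "\<exists>U\<in>lmeasurable. narrow_set Z \<eta> {a<..<b} n \<subseteq> U \<and>
    measure lebesgue U \<le> real (Suc (card Z)) ^ i * (2 * (\<eta> / \<beta> ^ (n + i * L)))"
  using J
proof (induction i arbitrary: a b n)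
  case (0 a b n)
  let ?S = "narrow_set Z \<eta> {a<..<b} n"
  show ?case
  proof (cases "?S = {}")
    case True
    show ?thesis unfolding True using \<eta>(1) beta by (intro bexI[of _ "{}"]) auto
  next
    case False
    then obtain \<alpha> where \<alpha>: "\<alpha> \<in> {a<..<b}" "\<not> wide Z \<eta> \<alpha> n" by (auto simp: narrow_set_def)
    then have "b - a \<le> 2 * (\<eta> / \<beta> ^ n)"
      using narrow_clear_interval[OF 0(2)] \<eta>(1) by blast
    then show ?thesis using \<alpha>(1) by (intro bexI[of _ "{a<..<b}"]) (auto simp: narrow_set_def)
  qed
next
  case (Suc i a b n)
  let ?S = "narrow_set Z \<eta>"
  let ?k = "real (Suc (card Z))"
  show ?case
  proof (cases "?S {a<..<b} n = {}")
    case True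
    show ?thesis unfolding True using \<eta>(1) beta by (intro bexI[of _ "{}"]) auto
  next
    case False
    then obtain \<alpha> where \<alpha>: "\<alpha> \<in> {a<..<b}" "\<not> wide Z \<eta> \<alpha> n" by (auto simp: narrow_set_def)
    have ba: "b - a \<le> 2 * (\<eta> / \<beta> ^ n)"
      by (rule narrow_clear_interval[OF Suc.prems(2) \<alpha> \<eta>(1)])
    have "slope (n + L) * (b - a) \<le> \<beta> ^ (n + L) / (\<beta> - 1) * (2 * (\<eta> / \<beta> ^ n))"
      using ba slope_upper \<alpha>(1) beta by (intro mult_mono) auto
    also have "\<dots> = 2 * \<eta> * \<beta> ^ L / (\<beta> - 1)" using beta by (simp add: power_add)
    finally have short: "slope (n + L) * (b - a) < r" using \<eta>(2) by simp
    have "\<forall>z\<in>Z. \<exists>p. {\<alpha>\<in>{a<..<b}. \<exists>i<n + L. hits \<alpha> z i} \<subseteq> {p}"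
      using Suc.prems ends by (intro ballI at_most_one_hit[OF r _ _ short]) (auto simp: clear_def)
    then obtain p where p: "\<And>z. z \<in> Z \<Longrightarrow> {\<alpha>\<in>{a<..<b}. \<exists>i<n + L. hits \<alpha> z i} \<subseteq> {p z}" by metis
    \<comment> \<open>Cut at all crossings of the next \<open>L\<close> steps.\<close>
    define P where "P = {\<alpha>\<in>{a<..<b}. \<exists>z\<in>Z. \<exists>i<n + L. hits \<alpha> z i}"
    have "P \<subseteq> p ` Z" unfolding P_def using p by blast
    then have P: "finite P" "card P \<le> card Z"
      using fin by (auto intro: finite_subset surj_card_le)
    obtain \<J> where J: "finite \<J>" "card \<J> \<le> Suc (card P)"
      "{a<..<b} - P \<subseteq> (\<Union>(a', b')\<in>\<J>. {a'<..<b'})"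
      "\<And>a' b'. (a', b') \<in> \<J> \<Longrightarrow> {a'<..<b'} \<subseteq> {a<..<b} - P"
      using split_interval_at_finite_set[OF P(1), of a b] by blast
    define B where "B = ?k ^ i * (2 * (\<eta> / \<beta> ^ (n + L + i * L)))"
    have "\<forall>q\<in>\<J>. \<exists>U. U \<in> lmeasurable \<and> ?S {fst q<..<snd q} (n + L) \<subseteq> U \<and> measure lebesgue U \<le> B"
    proof
      fix q assume q: "q \<in> \<J>"
      have sub: "{fst q<..<snd q} \<subseteq> {a<..<b} - P" using J(4)[of "fst q" "snd q"] q by simp
      then have "clear Z {fst q<..<snd q} (n + L)" unfolding clear_def P_def by blast
      moreover have "{fst q<..<snd q} \<subseteq> W" using sub Suc.prems(1) by blast
      ultimately show "\<exists>U. U \<in> lmeasurable \<and> ?S {fst q<..<snd q} (n + L) \<subseteq> U \<and> measure lebesgue U \<le> B"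
        using Suc.IH[of "fst q" "snd q" "n + L"] unfolding B_def by blast
    qed
    from bchoice[OF this] obtain U where U': "\<forall>q\<in>\<J>. U q \<in> lmeasurable \<and>
      ?S {fst q<..<snd q} (n + L) \<subseteq> U q \<and> measure lebesgue (U q) \<le> B" ..
    have U: "U q \<in> lmeasurable" "?S {fst q<..<snd q} (n + L) \<subseteq> U q" "measure lebesgue (U q) \<le> B"
      if "q \<in> \<J>" for q
      using bspec[OF U' that] by auto
    have B: "0 \<le> B" using \<eta>(1) beta by (simp add: B_def)
    show ?thesis
    proof (intro bexI[of _ "\<Union>q\<in>\<J>. U q"] conjI)
      show "(\<Union>q\<in>\<J>. U q) \<in> lmeasurable" using J(1) U(1) by (intro fmeasurable.finite_UN) auto
      show "?S {a<..<b} n \<subseteq> (\<Union>q\<in>\<J>. U q)"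
      proof
        fix x assume x: "x \<in> ?S {a<..<b} n"
        then have "x \<in> {a<..<b} - P" by (auto simp: P_def narrow_set_def)
        then obtain q where "q \<in> \<J>" "x \<in> {fst q<..<snd q}" using J(3) by fastforce
        moreover have "x \<in> ?S {fst q<..<snd q} (n + L)"
          using x \<open>x \<in> {fst q<..<snd q}\<close> by (simp add: narrow_set_def)
        ultimately show "x \<in> (\<Union>q\<in>\<J>. U q)" using U(2) by blast
      qed
      have "measure lebesgue (\<Union>q\<in>\<J>. U q) \<le> (\<Sum>q\<in>\<J>. measure lebesgue (U q))"
        using U(1) by (intro measure_UNION_le J) auto
      also have "\<dots> \<le> (\<Sum>q\<in>\<J>. B)" by (intro sum_mono U(3))
      also have "\<dots> = card \<J> * B" by simp
      also have "\<dots> \<le> ?k * B" using J(2) P(2) B by (intro mult_right_mono) auto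
      also have "\<dots> = ?k ^ Suc i * (2 * (\<eta> / \<beta> ^ (n + Suc i * L)))"
        by (simp add: B_def add.assoc)
      finally show "measure lebesgue (\<Union>q\<in>\<J>. U q) \<le> ?k ^ Suc i * (2 * (\<eta> / \<beta> ^ (n + Suc i * L)))" .
    qed
  qed
qed

text \<open>If \<open>L\<close> is so large that \<open>\<beta>^L\<close> exceeds the number of pieces per round, the total length of the pieces
  tends to zero. The radius and \<open>\<eta>\<close> depend on \<open>\<alpha>\<^sub>0\<close> through the distance that the first \<open>L\<close> points
  of the orbits of \<open>0\<close> and \<open>1\<close> keep from the jumps.\<close>

lemma narrow_negligible_near:
  assumes fin: "finite Z" and nh: "\<And>j. \<not> hits \<alpha>\<^sub>0 0 j" "\<And>j. \<not> hits \<alpha>\<^sub>0 1 j"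
  shows "\<exists>r>0. \<exists>\<eta>>0. negligible {\<alpha>\<in>ball \<alpha>\<^sub>0 r. (\<forall>z\<in>Z. \<forall>j. \<not> hits \<alpha> z j) \<and> finite {n. wide Z \<eta> \<alpha> n}}"
proof -
  obtain L where L: "real (Suc (card Z)) < \<beta> ^ L" using real_arch_pow[OF beta] by blast
  obtain r0 where r0: "r0 > 0" "\<And>\<alpha> x j. \<bar>\<alpha> - \<alpha>\<^sub>0\<bar> < r0 \<Longrightarrow> \<bar>x - 0\<bar> < r0 \<Longrightarrow> j < L \<Longrightarrow> \<not> hits \<alpha> x j"
    using orbit_affine_near[of L \<alpha>\<^sub>0 0] nh(1) by blast
  obtain r1 where r1: "r1 > 0" "\<And>\<alpha> x j. \<bar>\<alpha> - \<alpha>\<^sub>0\<bar> < r1 \<Longrightarrow> \<bar>x - 1\<bar> < r1 \<Longrightarrow> j < L \<Longrightarrow> \<not> hits \<alpha> x j"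
    using orbit_affine_near[of L \<alpha>\<^sub>0 1] nh(2) by blast
  define r where "r = min 1 (min r0 r1)"
  have r: "0 < r" "r \<le> 1" using r0 r1 by (auto simp: r_def)
  have ends: "\<not> hits \<alpha> y l" if "\<alpha> \<in> ball \<alpha>\<^sub>0 r" "\<bar>y\<bar> < r \<or> \<bar>y - 1\<bar> < r" "l < L" for \<alpha> y l
    using r0(2)[of \<alpha> y l] r1(2)[of \<alpha> y l] that by (auto simp: r_def dist_real_def abs_minus_commute)
  \<comment> \<open>Intervals of length \<open>2 \<eta> / \<beta>^n\<close> are stretched to at most \<open>r / 2\<close> by time \<open>n + L\<close>.\<close>
  define \<eta> where "\<eta> = r * (\<beta> - 1) / (4 * \<beta> ^ L)"
  have \<eta>: "0 < \<eta>" using r beta by (simp add: \<eta>_def)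
  have "2 * \<eta> * \<beta> ^ L / (\<beta> - 1) = r / 2" using beta unfolding \<eta>_def by (simp add: field_simps)
  then have \<eta>2: "2 * \<eta> * \<beta> ^ L / (\<beta> - 1) < r" using r by simp
  let ?S = "narrow_set Z \<eta>"
  have S_interval: "negligible (?S {a<..<b} n)"
    if J: "{a<..<b} \<subseteq> ball \<alpha>\<^sub>0 r" "clear Z {a<..<b} n" for a b n
    unfolding negligible_outer_le
  proof (intro allI impI)
    fix e :: real assume "e > 0"
    let ?q = "real (Suc (card Z)) / \<beta> ^ L"
    have "(\<lambda>i. 2 * (\<eta> / \<beta> ^ n) * ?q ^ i) \<longlonglongrightarrow> 2 * (\<eta> / \<beta> ^ n) * 0"
      using L beta by (intro tendsto_mult tendsto_const LIMSEQ_realpow_zero) auto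
    then have "\<forall>\<^sub>F i in sequentially. 2 * (\<eta> / \<beta> ^ n) * ?q ^ i < e"
      using \<open>e > 0\<close> by (intro order_tendstoD) auto
    then obtain i where i: "2 * (\<eta> / \<beta> ^ n) * ?q ^ i < e" by (auto simp: eventually_sequentially)
    obtain U where U: "U \<in> lmeasurable" "?S {a<..<b} n \<subseteq> U"
      "measure lebesgue U \<le> real (Suc (card Z)) ^ i * (2 * (\<eta> / \<beta> ^ (n + i * L)))"
      using narrow_cover[OF r fin ends \<eta> \<eta>2 J] by blast
    have "real (Suc (card Z)) ^ i * (2 * (\<eta> / \<beta> ^ (n + i * L))) = 2 * (\<eta> / \<beta> ^ n) * ?q ^ i"
      by (simp add: power_add power_mult power_divide mult.commute[of i L])
    then show "\<exists>T. ?S {a<..<b} n \<subseteq> T \<and> T \<in> lmeasurable \<and> measure lebesgue T \<le> e"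
      using U i by (intro exI[of _ U]) auto
  qed
  have S_ball: "negligible (?S (ball \<alpha>\<^sub>0 r) n)" for n
  proof (subst locally_negligible_alt, intro ballI)
    fix \<alpha> assume \<alpha>: "\<alpha> \<in> ?S (ball \<alpha>\<^sub>0 r) n"
    have nh: "\<forall>z\<in>Z. \<forall>j. \<not> hits \<alpha> z j" and "\<alpha> \<in> ball \<alpha>\<^sub>0 r"
      using \<alpha> by (simp_all add: narrow_set_def)
    have "\<exists>e>0. clear Z (ball \<alpha> e) n" by (rule clear_near[OF fin]) (use nh in blast)
    then obtain e1 where e1: "e1 > 0" "clear Z (ball \<alpha> e1) n" by blast
    obtain e2 where e2: "e2 > 0" "ball \<alpha> e2 \<subseteq> ball \<alpha>\<^sub>0 r"
      using openE[OF open_ball \<open>\<alpha> \<in> ball \<alpha>\<^sub>0 r\<close>] by blast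
    define e where "e = min e1 e2"
    have e: "e > 0" "ball \<alpha> e \<subseteq> ball \<alpha>\<^sub>0 r" "clear Z (ball \<alpha> e) n"
      using e1 e2 by (auto simp: e_def clear_def)
    then have "negligible (?S (ball \<alpha> e) n)"
      using S_interval[of "\<alpha> - e" "\<alpha> + e" n] by (simp only: ball_eq_greaterThanLessThan)
    moreover have "?S (ball \<alpha>\<^sub>0 r) n \<inter> ball \<alpha> e \<subseteq> ?S (ball \<alpha> e) n"
      by (auto simp: narrow_set_def)
    ultimately have "negligible (?S (ball \<alpha>\<^sub>0 r) n \<inter> ball \<alpha> e)" by (rule negligible_subset)
    moreover have "openin (top_of_set (?S (ball \<alpha>\<^sub>0 r) n)) (?S (ball \<alpha>\<^sub>0 r) n \<inter> ball \<alpha> e)"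
      by (intro openin_open_Int open_ball)
    ultimately show "\<exists>U. openin (top_of_set (?S (ball \<alpha>\<^sub>0 r) n)) U \<and> \<alpha> \<in> U \<and> negligible U"
      using \<alpha> e(1) by (intro exI[of _ "?S (ball \<alpha>\<^sub>0 r) n \<inter> ball \<alpha> e"]) auto
  qed
  have "{\<alpha>\<in>ball \<alpha>\<^sub>0 r. (\<forall>z\<in>Z. \<forall>j. \<not> hits \<alpha> z j) \<and> finite {n. wide Z \<eta> \<alpha> n}}
      \<subseteq> (\<Union>n. ?S (ball \<alpha>\<^sub>0 r) n)"
  proof
    fix \<alpha> assume \<alpha>: "\<alpha> \<in> {\<alpha>\<in>ball \<alpha>\<^sub>0 r. (\<forall>z\<in>Z. \<forall>j. \<not> hits \<alpha> z j) \<and> finite {n. wide Z \<eta> \<alpha> n}}"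
    then have "finite {n. wide Z \<eta> \<alpha> n}" by simp
    then obtain n where "\<forall>m\<in>{n. wide Z \<eta> \<alpha> n}. m < n" unfolding finite_nat_set_iff_bounded ..
    then have "\<forall>m\<ge>n. \<not> wide Z \<eta> \<alpha> m" by (metis mem_Collect_eq not_le)
    then have "\<alpha> \<in> ?S (ball \<alpha>\<^sub>0 r) n" using \<alpha> by (simp add: narrow_set_def)
    then show "\<alpha> \<in> (\<Union>n. ?S (ball \<alpha>\<^sub>0 r) n)" by blast
  qed
  moreover have "negligible (\<Union>n. ?S (ball \<alpha>\<^sub>0 r) n)"
    using S_ball by (intro negligible_countable_Union) auto
  ultimately show ?thesis using r(1) \<eta> negligible_subset by blast
qed

lemma almost_all_infinitely_often_wide:
  assumes fin: "finite Z" and Z: "0 \<in> Z" "1 \<in> Z"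
  shows "negligible {\<alpha>. (\<forall>z\<in>Z. \<forall>j. \<not> hits \<alpha> z j) \<and> (\<forall>\<eta>>0. finite {n. wide Z \<eta> \<alpha> n})}"
    (is "negligible ?Q")
proof (subst locally_negligible_alt, intro ballI)
  fix \<alpha> assume \<alpha>: "\<alpha> \<in> ?Q"
  then obtain r \<eta> where r: "r > 0" "\<eta> > 0"
    and n: "negligible {\<alpha>'\<in>ball \<alpha> r. (\<forall>z\<in>Z. \<forall>j. \<not> hits \<alpha>' z j) \<and> finite {n. wide Z \<eta> \<alpha>' n}}"
    using narrow_negligible_near[OF fin, of \<alpha>] Z by auto
  have "negligible (?Q \<inter> ball \<alpha> r)" by (rule negligible_subset[OF n]) (use r in auto)
  then show "\<exists>U. openin (top_of_set ?Q) U \<and> \<alpha> \<in> U \<and> negligible U"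
    using \<alpha> r by (intro exI[of _ "?Q \<inter> ball \<alpha> r"]) auto
qed

end

section \<open>Matching for almost every parameter\<close>

text \<open>The last assumption says that \<open>D\<close> contains, with the difference of two points, also the
  difference of their images, which is smaller than \<open>1\<close> in absolute value.\<close>

locale finite_differences = expanding_beta +
  fixes D :: "real set"
  assumes finite_D: "finite D" and D_0: "0 \<in> D" and D_1: "1 \<in> D"
    and D_uminus: "\<And>d. d \<in> D \<Longrightarrow> - d \<in> D"
    and D_step: "\<And>d (k :: int). d \<in> D \<Longrightarrow> \<bar>\<beta> * d - k\<bar> < 1 \<Longrightarrow> \<beta> * d - k \<in> D"
begin

text \<open>Every admissible set is contained in \<open>D\<close> because it contains \<open>0\<close>; so there are finitely many of them.\<close>

definition admissible :: "real set \<Rightarrow> bool" where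
  "admissible Z \<longleftrightarrow> Z \<subseteq> {0..1} \<and> 0 \<in> Z \<and> 1 \<in> Z \<and> (\<forall>x\<in>Z. \<forall>y\<in>Z. x - y \<in> D)"

definition unmerged :: "real set \<Rightarrow> real set" where
  "unmerged Z = {\<alpha>. \<forall>n. inj_on (T \<alpha> ^^ n) Z}"

definition regular :: "real set" where
  "regular = {\<alpha>. \<forall>d\<in>D. \<forall>n. \<not> hits \<alpha> d n}"

lemma admissible_subset: "admissible Z \<Longrightarrow> Z \<subseteq> D"
  unfolding admissible_def by (metis diff_zero subsetI)

lemma admissible_finite: "admissible Z \<Longrightarrow> finite Z"
  using admissible_subset finite_D finite_subset by blast

lemma countable_not_regular: "countable (- regular)"
proof -
  have "- regular = (\<Union>d\<in>D. \<Union>n. {\<alpha>. hits \<alpha> d n})" by (auto simp: regular_def)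
  then show ?thesis using finite_D hits_countable(1) by (auto intro: countable_finite)
qed

lemma difference_step:
  assumes "x - y \<in> D"
  shows "T \<alpha> x - T \<alpha> y \<in> D"
proof -
  let ?k = "\<lfloor>\<beta> * x + \<alpha>\<rfloor> - \<lfloor>\<beta> * y + \<alpha>\<rfloor>"
  have e: "T \<alpha> x - T \<alpha> y = \<beta> * (x - y) - ?k"
    by (simp add: T_map_def frac_def algebra_simps)
  moreover have "\<bar>T \<alpha> x - T \<alpha> y\<bar> < 1" using T_range[of \<alpha> x] T_range[of \<alpha> y] by linarith
  ultimately show ?thesis using D_step[OF assms, of ?k] by (simp only:)
qed

lemma orbit_difference: "x - y \<in> D \<Longrightarrow> (T \<alpha> ^^ n) x - (T \<alpha> ^^ n) y \<in> D"
  by (induction n) (auto intro: difference_step)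

text \<open>Both orbits move with the same speed in the parameter and in the translation, so they still meet
  after a small change.\<close>

lemma merging_is_stable:
  assumes "\<And>j. \<not> hits \<alpha>\<^sub>0 x j" "\<And>j. \<not> hits \<alpha>\<^sub>0 y j" "(T \<alpha>\<^sub>0 ^^ n) x = (T \<alpha>\<^sub>0 ^^ n) y"
  shows "\<exists>r>0. \<forall>\<alpha> t. \<bar>\<alpha> - \<alpha>\<^sub>0\<bar> < r \<longrightarrow> \<bar>t\<bar> < r \<longrightarrow> (T \<alpha> ^^ n) (x + t) = (T \<alpha> ^^ n) (y + t)"
proof -
  obtain r1 where r1: "r1 > 0" "\<And>\<alpha> x'. \<bar>\<alpha> - \<alpha>\<^sub>0\<bar> < r1 \<Longrightarrow> \<bar>x' - x\<bar> < r1 \<Longrightarrow>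
      (T \<alpha> ^^ n) x' = (T \<alpha>\<^sub>0 ^^ n) x + \<beta> ^ n * (x' - x) + slope n * (\<alpha> - \<alpha>\<^sub>0)"
    using orbit_affine_near[of n \<alpha>\<^sub>0 x] assms(1) by blast
  obtain r2 where r2: "r2 > 0" "\<And>\<alpha> y'. \<bar>\<alpha> - \<alpha>\<^sub>0\<bar> < r2 \<Longrightarrow> \<bar>y' - y\<bar> < r2 \<Longrightarrow>
      (T \<alpha> ^^ n) y' = (T \<alpha>\<^sub>0 ^^ n) y + \<beta> ^ n * (y' - y) + slope n * (\<alpha> - \<alpha>\<^sub>0)"
    using orbit_affine_near[of n \<alpha>\<^sub>0 y] assms(2) by blast
  show ?thesis
  proof (intro exI[of _ "min r1 r2"] conjI allI impI)
    fix \<alpha> t assume "\<bar>\<alpha> - \<alpha>\<^sub>0\<bar> < min r1 r2" "\<bar>t\<bar> < min r1 r2"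
    then show "(T \<alpha> ^^ n) (x + t) = (T \<alpha> ^^ n) (y + t)"
      using r1(2)[of \<alpha> "x + t"] r2(2)[of \<alpha> "y + t"] assms(3) by simp
  qed (use r1 r2 in auto)
qed

lemma generic_translation:
  assumes "finite Z" "(a::real) < b"
  shows "\<exists>x\<in>{a<..<b}. \<forall>z\<in>Z. \<forall>j. \<not> hits \<alpha> (x + \<delta> z) j"
proof (rule ccontr)
  assume "\<not> ?thesis"
  then have "{a<..<b} \<subseteq> (\<Union>z\<in>Z. \<Union>j. (\<lambda>y. y - \<delta> z) ` {y. hits \<alpha> y j})"
    by (force simp: image_iff)
  moreover have "countable (\<Union>z\<in>Z. \<Union>j. (\<lambda>y. y - \<delta> z) ` {y. hits \<alpha> y j})"
    using assms(1) hits_countable(2) by (auto intro: countable_finite)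
  ultimately have "countable {a<..<b}" by (rule countable_subset)
  then show False using assms(2) uncountable_open_interval by blast
qed

text \<open>Otherwise all iterates would be affine on the interval and stretch it beyond length \<open>1\<close>.\<close>

lemma some_translation_hits:
  assumes "a < b"
  shows "\<exists>i. \<exists>x\<in>{a<..<b}. hits \<alpha> (x + \<delta>) i"
proof (rule ccontr)
  assume *: "\<not> ?thesis"
  define x where "x = (2 * a + b) / 3"
  define x' where "x' = (a + 2 * b) / 3"
  have x: "x \<in> {a<..<b}" "x' \<in> {a<..<b}" "0 < x' - x" using assms by (auto simp: x_def x'_def)
  obtain n where n: "1 / (x' - x) < \<beta> ^ n" using real_arch_pow[OF beta] by blast
  have "1 < \<beta> ^ n * (x' - x)" using n x(3) by (simp only: pos_divide_less_eq)
  also have "\<dots> \<le> \<beta> ^ Suc n * (x' - x)" using beta x(3) by (intro mult_right_mono power_increasing) auto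
  finally have n': "1 < \<beta> ^ Suc n * (x' - x)" .
  have "(T \<alpha> ^^ Suc n) (x' + \<delta>) = (T \<alpha> ^^ Suc n) (x + \<delta>) + \<beta> ^ Suc n * ((x' + \<delta>) - (x + \<delta>))"
  proof (rule orbit_affine_in_point[of "{a + \<delta><..<b + \<delta>}"])
    show "\<not> hits \<alpha> y j" if "y \<in> {a + \<delta><..<b + \<delta>}" for y j
    proof -
      have "y - \<delta> \<in> {a<..<b}" using that by auto
      then have "\<not> hits \<alpha> (y - \<delta> + \<delta>) j" using * by blast
      then show ?thesis by simp
    qed
  qed (use x in auto)
  moreover have "(x' + \<delta>) - (x + \<delta>) = x' - x" by simp
  ultimately have "(T \<alpha> ^^ Suc n) (x' + \<delta>) = (T \<alpha> ^^ Suc n) (x + \<delta>) + \<beta> ^ Suc n * (x' - x)"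
    by (simp only:)
  then show False using n' T_range[of \<alpha> "(T \<alpha> ^^ n) (x' + \<delta>)"] T_range[of \<alpha> "(T \<alpha> ^^ n) (x + \<delta>)"]
    unfolding funpow.simps o_apply by linarith
qed

text \<open>The heart of the induction: a configuration, given by offsets \<open>\<delta> z\<close> from a moving base point, all of
  whose generic translates keep their points apart, yields a larger admissible set with the same
  property. The new points are the one-sided limits at the first crossing of a jump: the crossing point
  has the limits \<open>0\<close> and \<open>1\<close>, the others have one limit each.\<close>

lemma larger_unmerged_set:
  assumes Z: "admissible Z" and reg: "\<alpha> \<in> regular" and un: "\<alpha> \<in> unmerged Z"
    and \<delta>: "\<And>z z'. z \<in> Z \<Longrightarrow> z' \<in> Z \<Longrightarrow> \<delta> z - \<delta> z' \<in> D" and ab: "a < b"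
    and sep: "\<And>x n. x \<in> {a<..<b} \<Longrightarrow> (\<forall>z\<in>Z. \<forall>j. \<not> hits \<alpha> (x + \<delta> z) j) \<Longrightarrow>
       inj_on (\<lambda>z. (T \<alpha> ^^ n) (x + \<delta> z)) Z"
  shows "\<exists>Z'. admissible Z' \<and> card Z' = Suc (card Z) \<and> \<alpha> \<in> unmerged Z'"
proof -
  have finZ: "finite Z" using Z by (rule admissible_finite)
  have Z01: "0 \<in> Z" "1 \<in> Z" using Z by (auto simp: admissible_def)
  define Q where "Q i \<longleftrightarrow> (\<exists>x\<in>{a<..<b}. \<exists>z\<in>Z. hits \<alpha> (x + \<delta> z) i)" for i
  define i where "i = (LEAST i. Q i)"
  have "\<exists>i. Q i" using some_translation_hits[OF ab, of \<alpha> "\<delta> 0"] Z01 by (auto simp: Q_def)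
  then have "Q i" unfolding i_def by (rule LeastI_ex)
  then obtain x1 z1 where x1: "x1 \<in> {a<..<b}" and z1: "z1 \<in> Z" "hits \<alpha> (x1 + \<delta> z1) i"
    by (auto simp: Q_def)
  have before: "\<not> hits \<alpha> (x + \<delta> z) j" if "x \<in> {a<..<b}" "z \<in> Z" "j < i" for x z j
    using not_less_Least[of j Q] that by (auto simp: i_def Q_def)
  define v where "v z = \<beta> * (T \<alpha> ^^ i) (x1 + \<delta> z) + \<alpha>" for z
  have v1: "v z1 \<in> \<int>" using z1(2) by (simp add: v_def hits_def)
  \<comment> \<open>Limits of the image of the configuration from the right and from the left at the crossing.\<close>
  define R where "R z = frac (v z)" for z
  define L where "L z = (if v z \<in> \<int> then 1 else frac (v z))" for z
  have R: "0 \<le> R z" "R z < 1" "R z = 0 \<longleftrightarrow> v z \<in> \<int>" for z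
    by (simp_all add: R_def frac_lt_1)
  define q where "q = \<beta> ^ Suc i"
  have v_near: "\<beta> * (T \<alpha> ^^ i) (x1 + t + \<delta> z) + \<alpha> = v z + q * t"
    if "z \<in> Z" "x1 + t \<in> {a<..<b}" for z t
  proof -
    have "(T \<alpha> ^^ i) (x1 + t + \<delta> z) = (T \<alpha> ^^ i) (x1 + \<delta> z) + \<beta> ^ i * ((x1 + t + \<delta> z) - (x1 + \<delta> z))"
    proof (rule orbit_affine_in_point[of "{a + \<delta> z<..<b + \<delta> z}"])
      show "\<not> hits \<alpha> y j" if "y \<in> {a + \<delta> z<..<b + \<delta> z}" "j < i" for y j
        using before[of "y - \<delta> z" z j] that \<open>z \<in> Z\<close> by auto
    qed (use that x1 in auto)
    then show ?thesis unfolding v_def q_def by (simp only:) (simp add: algebra_simps)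
  qed
  have "\<exists>s>0. s \<le> 1 \<and> (\<forall>z\<in>Z. v z \<notin> \<int> \<longrightarrow> s \<le> frac (v z) \<and> s \<le> 1 - frac (v z))"
    using finZ
  proof (induction Z rule: finite_induct)
    case empty
    show ?case by (intro exI[of _ 1]) simp
  next
    case (insert z Z)
    then obtain s where s: "s > 0" "s \<le> 1" "\<forall>z\<in>Z. v z \<notin> \<int> \<longrightarrow> s \<le> frac (v z) \<and> s \<le> 1 - frac (v z)" by blast
    show ?case
    proof (cases "v z \<in> \<int>")
      case True
      then show ?thesis using s by (intro exI[of _ s]) auto
    next
      case False
      then have "0 < frac (v z)" using frac_ge_0[of "v z"] by (simp add: less_le)
      then show ?thesis using s frac_lt_1[of "v z"]
        by (intro exI[of _ "min s (min (frac (v z)) (1 - frac (v z)))"]) auto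
    qed
  qed
  then obtain s where s: "s > 0" "s \<le> 1"
    "\<And>z. z \<in> Z \<Longrightarrow> v z \<notin> \<int> \<Longrightarrow> s \<le> frac (v z) \<and> s \<le> 1 - frac (v z)" by blast
  \<comment> \<open>For translations by less than \<open>r\<close> only the points at a jump cross one.\<close>
  define r where "r = min (min (x1 - a) (b - x1)) (s / q)"
  have \<beta>i: "0 < q" using beta by (simp add: q_def)
  have r: "r > 0" using x1 s(1) \<beta>i by (simp add: r_def)
  have small: "x1 + t \<in> {a<..<b}" "q * \<bar>t\<bar> < s" if "\<bar>t\<bar> < r" for t
  proof -
    show "x1 + t \<in> {a<..<b}" using that by (auto simp: r_def)
    have "\<bar>t\<bar> < s / q" using that by (simp add: r_def)
    then show "q * \<bar>t\<bar> < s" using \<beta>i by (simp only: pos_less_divide_eq mult.commute)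
  qed
  have orbit_near: "(T \<alpha> ^^ Suc i) (x1 + t + \<delta> z) = (if t > 0 then R z else L z) + q * t"
    if zt: "z \<in> Z" "\<bar>t\<bar> < r" "t \<noteq> 0" for z t
  proof -
    have "(T \<alpha> ^^ Suc i) (x1 + t + \<delta> z) = frac (v z + q * t)"
      by (simp only: orbit_Suc v_near[OF zt(1) small(1)[OF zt(2)]])
    also have "\<dots> = (if t > 0 then R z else L z) + q * t"
    proof (cases "v z \<in> \<int>")
      case True
      have "\<bar>q * t\<bar> < 1" using small(2)[OF zt(2)] s(2) \<beta>i by (simp add: abs_mult)
      moreover have "t > 0 \<Longrightarrow> q * t > 0" "t < 0 \<Longrightarrow> q * t < 0"
        using \<beta>i by (auto simp: mult_pos_neg)
      ultimately show ?thesis using True zt(3) R(3)[of z] unfolding L_def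
        by (subst frac_unique_iff) (auto simp: algebra_simps abs_if)
    next
      case False
      have "\<bar>q * t\<bar> < s" using small(2)[OF zt(2)] \<beta>i by (simp add: abs_mult)
      then show ?thesis using s(3)[OF zt(1) False] False frac_add_small(1)[of "v z" "q * t"]
        by (auto simp: R_def L_def)
    qed
    finally show ?thesis .
  qed
  have generic: "\<exists>t\<in>{c<..<d}. \<forall>z\<in>Z. \<forall>j. \<not> hits \<alpha> (x1 + t + \<delta> z) j" if "c < d" for c d
    using generic_translation[OF finZ that, of \<alpha> "\<lambda>z. x1 + \<delta> z"] by (simp add: add_ac)
  have D_near: "(T \<alpha> ^^ Suc i) (x1 + t + \<delta> z) - (T \<alpha> ^^ Suc i) (x1 + t + \<delta> z') \<in> D"
    if "z \<in> Z" "z' \<in> Z" for z z' t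
    using \<delta>[OF that] by (intro orbit_difference) simp
  have DR: "R z - R z' \<in> D" if "z \<in> Z" "z' \<in> Z" for z z'
    using D_near[OF that, of "r / 2"] orbit_near[OF that(1), of "r / 2"] orbit_near[OF that(2), of "r / 2"] r
    by (simp del: funpow.simps)
  have DL: "L z - L z' \<in> D" if "z \<in> Z" "z' \<in> Z" for z z'
    using D_near[OF that, of "- r / 2"] orbit_near[OF that(1), of "- r / 2"] orbit_near[OF that(2), of "- r / 2"] r
    by (simp del: funpow.simps)
  have R1: "R z1 = 0" and L1: "L z1 = 1" using v1 by (simp_all add: R_def L_def)
  have reg_D: "\<not> hits \<alpha> d j" if "d \<in> D" for d j using reg that by (simp add: regular_def)
  have R_D: "R z \<in> D" if "z \<in> Z" for z using DR[OF that z1(1)] R1 by simp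
  have L_D: "L z \<in> D" if "z \<in> Z" for z using R_D[OF that] D_1 by (simp add: L_def R_def)
  \<comment> \<open>A merging of two limits would be inherited by the generic translates on the same side.\<close>
  have R_sep: "(T \<alpha> ^^ n) (R z) \<noteq> (T \<alpha> ^^ n) (R z')" if z: "z \<in> Z" "z' \<in> Z" "z \<noteq> z'" for z z' n
  proof
    assume "(T \<alpha> ^^ n) (R z) = (T \<alpha> ^^ n) (R z')"
    then obtain r' where r': "r' > 0" "\<And>t. \<bar>t\<bar> < r' \<Longrightarrow> (T \<alpha> ^^ n) (R z + t) = (T \<alpha> ^^ n) (R z' + t)"
      using merging_is_stable[of \<alpha> "R z" "R z'" n] reg_D R_D z by (metis abs_zero diff_self)
    have "0 < min r (r' / q)" using r r'(1) \<beta>i by simp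
    then obtain t where t: "t \<in> {0<..<min r (r' / q)}"
      and g: "\<forall>z\<in>Z. \<forall>j. \<not> hits \<alpha> (x1 + t + \<delta> z) j" using generic by blast
    have "t < r' / q" using t by simp
    then have "\<bar>q * t\<bar> < r'" using t \<beta>i by (simp only: pos_less_divide_eq) (simp add: abs_mult mult.commute)
    then have "(T \<alpha> ^^ n) ((T \<alpha> ^^ Suc i) (x1 + t + \<delta> z)) = (T \<alpha> ^^ n) ((T \<alpha> ^^ Suc i) (x1 + t + \<delta> z'))"
      using orbit_near[OF z(1), of t] orbit_near[OF z(2), of t] t r'(2) by (simp del: funpow.simps)
    moreover have "x1 + t \<in> {a<..<b}" using small(1)[of t] t by simp
    ultimately show False
      using sep[OF _ g, of "n + Suc i"] z by (simp only: orbit_add inj_on_def) blast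
  qed
  have L_sep: "(T \<alpha> ^^ n) (L z) \<noteq> (T \<alpha> ^^ n) (L z')" if z: "z \<in> Z" "z' \<in> Z" "z \<noteq> z'" for z z' n
  proof
    assume "(T \<alpha> ^^ n) (L z) = (T \<alpha> ^^ n) (L z')"
    then obtain r' where r': "r' > 0" "\<And>t. \<bar>t\<bar> < r' \<Longrightarrow> (T \<alpha> ^^ n) (L z + t) = (T \<alpha> ^^ n) (L z' + t)"
      using merging_is_stable[of \<alpha> "L z" "L z'" n] reg_D L_D z by (metis abs_zero diff_self)
    have "- min r (r' / q) < 0" using r r'(1) \<beta>i by simp
    then obtain t where t: "t \<in> {- min r (r' / q)<..<0}"
      and g: "\<forall>z\<in>Z. \<forall>j. \<not> hits \<alpha> (x1 + t + \<delta> z) j" using generic by blast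
    have tr: "\<bar>t\<bar> < r" "\<bar>t\<bar> < r' / q" "t < 0" using t by auto
    from tr(2) have "\<bar>q * t\<bar> < r'" using \<beta>i by (simp only: pos_less_divide_eq) (simp add: abs_mult mult.commute)
    then have "(T \<alpha> ^^ n) ((T \<alpha> ^^ Suc i) (x1 + t + \<delta> z)) = (T \<alpha> ^^ n) ((T \<alpha> ^^ Suc i) (x1 + t + \<delta> z'))"
      using orbit_near[OF z(1), of t] orbit_near[OF z(2), of t] tr r'(2) by (simp del: funpow.simps)
    moreover have "x1 + t \<in> {a<..<b}" using small(1)[of t] tr by simp
    ultimately show False
      using sep[OF _ g, of "n + Suc i"] z by (simp only: orbit_add inj_on_def) blast
  qed
  have R_inj: "inj_on R Z" using R_sep[of _ _ 0] by (auto simp: inj_on_def)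
  \<comment> \<open>Only one point crosses: two crossing points would have the same limit \<open>0\<close> from the right.\<close>
  have LR: "L z = R z" if "z \<in> Z" "z \<noteq> z1" for z
  proof -
    have "R z \<noteq> 0" using R_inj that z1(1) R1 by (metis inj_onD)
    then show ?thesis using R(3)[of z] by (simp add: L_def R_def)
  qed
  have D1: "1 - R z \<in> D" if "z \<in> Z" for z
    using DL[OF z1(1) that] LR[OF that] L1 R1 D_1 by (cases "z = z1") auto
  have sep1: "(T \<alpha> ^^ n) 1 \<noteq> (T \<alpha> ^^ n) (R z)" if "z \<in> Z" for z n
  proof (cases "z = z1")
    case True
    \<comment> \<open>The two limits \<open>1\<close> and \<open>0\<close> of the crossing point itself, which lie on different sides.\<close>
    have "inj_on (T \<alpha> ^^ n) Z" using un by (simp add: unmerged_def)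
    then show ?thesis using True R1 Z01 by (metis inj_onD zero_neq_one)
  next
    case False
    then show ?thesis using L_sep[OF z1(1) that, of n] LR[OF that] L1 by simp
  qed
  have "1 \<notin> R ` Z" using R(2) by (metis imageE less_irrefl)
  then have "card (insert 1 (R ` Z)) = Suc (card Z)"
    using finZ R_inj by (simp add: card_image)
  moreover have "admissible (insert 1 (R ` Z))"
  proof -
    have "0 \<in> R ` Z" using R1 z1(1) by (metis imageI)
    moreover have "R z \<le> 1" for z using R(2)[of z] by simp
    then have "insert 1 (R ` Z) \<subseteq> {0..1}" using R(1) by auto
    moreover have "R z - 1 \<in> D" if "z \<in> Z" for z using D_uminus[OF D1[OF that]] by simp
    ultimately show ?thesis using D1 DR D_0 by (auto simp: admissible_def)
  qed
  moreover have "\<alpha> \<in> unmerged (insert 1 (R ` Z))"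
  proof -
    have "inj_on (T \<alpha> ^^ n) (insert 1 (R ` Z))" for n
    proof (rule inj_onI)
      fix p p' assume p: "p \<in> insert 1 (R ` Z)" "p' \<in> insert 1 (R ` Z)" "(T \<alpha> ^^ n) p = (T \<alpha> ^^ n) p'"
      consider "p = 1" "p' = 1" | z where "z \<in> Z" "p = 1" "p' = R z" | z where "z \<in> Z" "p = R z" "p' = 1"
        | z z' where "z \<in> Z" "z' \<in> Z" "p = R z" "p' = R z'"
        using p(1,2) by blast
      then show "p = p'"
      proof cases
        case 2
        then show ?thesis using sep1[of z n] p(3) by simp
      next
        case 3
        then show ?thesis using sep1[of z n] p(3) by simp
      next
        case 4
        then show ?thesis using R_sep[of z z' n] p(3) by (cases "z = z'") auto
      qed simp
    qed
    then show ?thesis by (simp add: unmerged_def)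
  qed
  ultimately show ?thesis by blast
qed

text \<open>At a wide time \<open>n\<close> the configuration \<open>T^n Z\<close> has one of finitely many shapes \<open>\<delta> n\<close>, and while the
  parameter runs through the wide interval its base point covers one of finitely many
  fixed intervals. By the pigeonhole principle one shape and one interval serve
  infinitely many \<open>n\<close>. Some translate of this shape in this interval merges, by
  \<open>larger_unmerged_set\<close>; the parameters that lead close to this translate form the hole.\<close>

lemma unmerged_porous_at:
  assumes Z: "admissible Z" and reg: "\<alpha> \<in> regular" and un: "\<alpha> \<in> unmerged Z"
    and \<eta>: "0 < \<eta>" "infinite {n. wide Z \<eta> \<alpha> n}"
    and maximal: "\<And>Z'. admissible Z' \<Longrightarrow> card Z < card Z' \<Longrightarrow> \<alpha> \<notin> unmerged Z'"
  shows "\<exists>\<kappa>>0. porous_at (unmerged Z) \<kappa> \<alpha>"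
proof -
  have finZ: "finite Z" using Z by (rule admissible_finite)
  have Z01: "0 \<in> Z" "1 \<in> Z" using Z by (auto simp: admissible_def)
  define h where "h n = \<eta> / \<beta> ^ n" for n
  have h: "h n > 0" for n using \<eta>(1) beta by (simp add: h_def)
  define N where "N = {n. wide Z \<eta> \<alpha> n} - {0}"
  have N: "infinite N" using \<eta>(2) by (simp add: N_def)
  have "\<forall>n\<in>N. \<exists>c. \<alpha> \<in> ball c (h n) \<and> clear Z (ball c (h n)) n" by (simp add: N_def wide_def h_def)
  from bchoice[OF this] obtain c where c': "\<forall>n\<in>N. \<alpha> \<in> ball (c n) (h n) \<and> clear Z (ball (c n) (h n)) n" ..
  then have c: "\<alpha> \<in> ball (c n) (h n)" "clear Z (ball (c n) (h n)) n" if "n \<in> N" for n using that by auto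
  define u where "u n = (T (c n) ^^ n) 0" for n
  define \<delta> where "\<delta> n z = (T (c n) ^^ n) z - u n" for n z
  have u: "0 \<le> u n" "u n \<le> 1" for n using orbit_range[of 0 n "c n"] by (simp_all add: u_def)
  have \<delta>D: "\<delta> n z - \<delta> n z' \<in> D" if "z \<in> Z" "z' \<in> Z" for n z z'
    using that Z orbit_difference[of z z' n "c n"] by (simp add: \<delta>_def admissible_def)
  have \<delta>D0: "\<delta> n z \<in> D" if "z \<in> Z" for n z
    using \<delta>D[OF that Z01(1), of n] by (simp add: \<delta>_def u_def)
  have orbit: "(T a ^^ n) z = u n + \<delta> n z + slope n * (a - c n)"
    if "n \<in> N" "z \<in> Z" "a \<in> ball (c n) (h n)" for n z a
  proof -
    have "(T a ^^ n) z = (T (c n) ^^ n) z + slope n * (a - c n)"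
      using c(2)[OF that(1)] that h[of n]
      by (intro orbit_affine_in_parameter[of "ball (c n) (h n)"]) (auto simp: clear_def)
    then show ?thesis by (simp add: \<delta>_def)
  qed
  \<comment> \<open>The base point moves by at least \<open>2 \<rho>\<close> to either side of \<open>u n\<close>, so it covers every interval of
    radius \<open>\<rho>\<close> whose centre is at distance less than \<open>\<rho>\<close> from \<open>u n\<close>; the multiples of \<open>\<rho>\<close> suffice as centres.\<close>
  define \<rho> where "\<rho> = \<eta> / (2 * \<beta>)"
  have \<rho>: "0 < \<rho>" using \<eta>(1) beta by (simp add: \<rho>_def)
  define f where "f n = (\<lfloor>u n / \<rho>\<rfloor>, restrict (\<delta> n) Z)" for n
  have "f ` N \<subseteq> {0..\<lfloor>1 / \<rho>\<rfloor>} \<times> (Z \<rightarrow>\<^sub>E D)"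
    using u \<rho> \<delta>D0 by (auto simp: f_def intro!: floor_mono divide_right_mono)
  moreover have "finite ({0..\<lfloor>1 / \<rho>\<rfloor>} \<times> (Z \<rightarrow>\<^sub>E D))"
    using finZ finite_D by (intro finite_cartesian_product finite_PiE) auto
  ultimately have "finite (f ` N)" by (rule finite_subset)
  then obtain n0 where n0: "n0 \<in> N" "infinite {n\<in>N. f n = f n0}"
    using pigeonhole_infinite[OF N] by blast
  define g where "g = \<rho> * of_int \<lfloor>u n0 / \<rho>\<rfloor>"
  have near: "\<bar>u n - g\<bar> < \<rho>" "\<And>z. z \<in> Z \<Longrightarrow> \<delta> n z = \<delta> n0 z" if "f n = f n0" for n
  proof -
    have fl: "\<lfloor>u n / \<rho>\<rfloor> = \<lfloor>u n0 / \<rho>\<rfloor>" and rs: "restrict (\<delta> n) Z = restrict (\<delta> n0) Z"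
      using that by (simp_all add: f_def)
    have "of_int \<lfloor>u n0 / \<rho>\<rfloor> \<le> u n / \<rho>" "u n / \<rho> < of_int \<lfloor>u n0 / \<rho>\<rfloor> + 1"
      unfolding fl[symmetric] by linarith+
    then have "g \<le> u n" "u n < g + \<rho>" using \<rho> by (simp_all add: g_def field_simps)
    then show "\<bar>u n - g\<bar> < \<rho>" by simp
    show "\<delta> n z = \<delta> n0 z" if "z \<in> Z" for z using rs that by (metis restrict_apply')
  qed
  have "\<exists>x\<in>{g - \<rho><..<g + \<rho>}. (\<forall>z\<in>Z. \<forall>j. \<not> hits \<alpha> (x + \<delta> n0 z) j) \<and>
      (\<exists>K. \<not> inj_on (\<lambda>z. (T \<alpha> ^^ K) (x + \<delta> n0 z)) Z)"
  proof (rule ccontr)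
    assume *: "\<not> ?thesis"
    have "g - \<rho> < g + \<rho>" using \<rho> by simp
    then have "\<exists>Z'. admissible Z' \<and> card Z' = Suc (card Z) \<and> \<alpha> \<in> unmerged Z'"
      using * by (intro larger_unmerged_set[OF Z reg un, where \<delta> = "\<delta> n0" and a = "g - \<rho>" and b = "g + \<rho>"] \<delta>D) blast+
    then show False using maximal by (metis lessI)
  qed
  then obtain x K where x: "x \<in> {g - \<rho><..<g + \<rho>}" and nh: "\<And>z j. z \<in> Z \<Longrightarrow> \<not> hits \<alpha> (x + \<delta> n0 z) j"
    and "\<not> inj_on (\<lambda>z. (T \<alpha> ^^ K) (x + \<delta> n0 z)) Z" by blast
  then obtain z z' where z: "z \<in> Z" "z' \<in> Z" "z \<noteq> z'"
    "(T \<alpha> ^^ K) (x + \<delta> n0 z) = (T \<alpha> ^^ K) (x + \<delta> n0 z')" by (auto simp: inj_on_def)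
  obtain r0 where r0: "r0 > 0" "\<And>a t. \<bar>a - \<alpha>\<bar> < r0 \<Longrightarrow> \<bar>t\<bar> < r0 \<Longrightarrow>
      (T a ^^ K) (x + \<delta> n0 z + t) = (T a ^^ K) (x + \<delta> n0 z' + t)"
    using merging_is_stable[OF nh[OF z(1)] nh[OF z(2)] z(4)] by blast
  define r where "r = min r0 (\<rho> - \<bar>x - g\<bar>)"
  have r: "r > 0" "r \<le> r0" "r + \<bar>x - g\<bar> \<le> \<rho>" using r0(1) x by (auto simp: r_def)
  \<comment> \<open>A hole of radius \<open>r\<close> in the phase space has radius at least \<open>r (\<beta> - 1) / \<beta>^n\<close> in the
    parameter, to be compared with \<open>h n = \<eta> / \<beta>^n\<close>.\<close>
  define \<kappa> where "\<kappa> = r * (\<beta> - 1) / \<eta>"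
  have \<kappa>: "\<kappa> > 0" using r(1) beta \<eta>(1) by (simp add: \<kappa>_def)
  have "porous_at (unmerged Z) \<kappa> \<alpha>"
    unfolding porous_at_def
  proof (intro allI impI)
    fix e :: real assume "e > 0"
    have "(\<lambda>n. \<eta> * (1 / \<beta>) ^ n) \<longlonglongrightarrow> \<eta> * 0"
      using beta by (intro tendsto_mult tendsto_const LIMSEQ_realpow_zero) auto
    then have "\<forall>\<^sub>F n in sequentially. \<eta> * (1 / \<beta>) ^ n < min e (r / 2)"
      using \<open>e > 0\<close> r(1) by (intro order_tendstoD) auto
    then obtain n1 where n1: "\<And>n. n \<ge> n1 \<Longrightarrow> h n < min e (r / 2)"
      unfolding eventually_sequentially h_def by (auto simp: power_one_over)
    obtain n where "n \<ge> n1" and n: "n \<in> N" "f n = f n0"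
      using n0(2) unfolding infinite_nat_iff_unbounded_le by blast
    have hn: "h n < e" "2 * h n < r" using n1[OF \<open>n \<ge> n1\<close>] by auto
    have "n \<noteq> 0" using n(1) by (simp add: N_def)
    define s where "s = slope n"
    have s: "0 < s" "\<beta> ^ n / \<beta> \<le> s" "s * (\<beta> - 1) \<le> \<beta> ^ n"
      using slope_pos[OF \<open>n \<noteq> 0\<close>] slope_lower[OF \<open>n \<noteq> 0\<close>] slope_upper[of n] beta
      by (simp_all add: s_def pos_le_divide_eq)
    \<comment> \<open>The parameter that moves the base point to \<open>x\<close>, by the affine formula for the orbit.\<close>
    define c' where "c' = c n + (x - u n) / s"
    have in_ball: "\<bar>u n + s * (a - c n) - x\<bar> < r" "a \<in> ball (c n) (h n)" if "a \<in> ball c' (\<kappa> * h n)" for a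
    proof -
      have "s * ((x - u n) / s) = x - u n" using s(1) by simp
      then have "u n + s * (a - c n) - x = s * (a - c')"
        by (simp add: c'_def right_diff_distrib distrib_left del: times_divide_eq_right)
      then have "\<bar>u n + s * (a - c n) - x\<bar> = s * \<bar>a - c'\<bar>" using s(1) by (simp add: abs_mult)
      also have "\<dots> < s * (\<kappa> * h n)" using that s(1) by (simp add: dist_real_def abs_minus_commute)
      also have "\<dots> = r * (s * (\<beta> - 1) / \<beta> ^ n)" using \<eta>(1) by (simp add: \<kappa>_def h_def)
      also have "\<dots> \<le> r * 1" using s(3) beta r(1) by (intro mult_left_mono) auto
      finally show 1: "\<bar>u n + s * (a - c n) - x\<bar> < r" by simp
      have "s * \<bar>a - c n\<bar> = \<bar>s * (a - c n)\<bar>" using s(1) by (simp add: abs_mult)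
      also have "\<dots> < 2 * \<rho>" using 1 near(1)[OF n(2)] r(3) by linarith
      also have "\<dots> = \<beta> ^ n / \<beta> * h n" using beta by (simp add: \<rho>_def h_def)
      also have "\<dots> \<le> s * h n" using s(2) h[of n] by (intro mult_right_mono) auto
      finally show "a \<in> ball (c n) (h n)" using s(1) by (simp add: dist_real_def abs_minus_commute)
    qed
    have "unmerged Z \<inter> ball c' (\<kappa> * h n) = {}"
    proof -
      have False if a: "a \<in> unmerged Z" "a \<in> ball c' (\<kappa> * h n)" for a
      proof -
        define t where "t = u n + s * (a - c n) - x"
        have "\<bar>a - \<alpha>\<bar> < r0" using in_ball(2)[OF a(2)] c(1)[OF n(1)] hn(2) r(2) by (auto simp: dist_real_def)
        moreover have "\<bar>t\<bar> < r0" using in_ball(1)[OF a(2)] r(2) by (simp add: t_def)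
        moreover have "(T a ^^ n) w = x + \<delta> n0 w + t" if "w \<in> Z" for w
          using orbit[OF n(1) that in_ball(2)[OF a(2)]] near(2)[OF n(2) that] by (simp add: t_def s_def)
        ultimately have "(T a ^^ (K + n)) z = (T a ^^ (K + n)) z'"
          using r0(2)[of a t] z by (simp add: orbit_add)
        moreover have "inj_on (T a ^^ (K + n)) Z" using a(1) by (simp add: unmerged_def)
        ultimately show False using z by (meson inj_onD)
      qed
      then show ?thesis by blast
    qed
    moreover have "ball c' (\<kappa> * h n) \<subseteq> ball (c n) (h n)" using in_ball(2) by blast
    ultimately show "\<exists>c h c'. 0 < h \<and> h < e \<and> \<alpha> \<in> ball c h \<and> ball c' (\<kappa> * h) \<subseteq> ball c h \<and>
        unmerged Z \<inter> ball c' (\<kappa> * h) = {}"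
      using h[of n] hn(1) c(1)[OF n(1)] by (intro exI conjI)
  qed
  then show ?thesis using \<kappa> by blast
qed

theorem unmerged_negligible: "admissible Z \<Longrightarrow> negligible (unmerged Z)"
proof (induction "card D - card Z" arbitrary: Z rule: less_induct)
  case (less Z)
  have finZ: "finite Z" using less.prems by (rule admissible_finite)
  have Z01: "0 \<in> Z" "1 \<in> Z" using less.prems by (auto simp: admissible_def)
  define \<Z> where "\<Z> = {Z'. admissible Z' \<and> card Z < card Z'}"
  define Q where "Q = {\<alpha>. (\<forall>z\<in>Z. \<forall>j. \<not> hits \<alpha> z j) \<and> (\<forall>\<eta>>0. finite {n. wide Z \<eta> \<alpha> n})}"
  have "\<Z> \<subseteq> Pow D" using admissible_subset by (auto simp: \<Z>_def)
  then have "finite \<Z>" using finite_D by (simp add: finite_subset)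
  have 1: "negligible (\<Union>Z'\<in>\<Z>. unmerged Z')"
  proof (rule negligible_Union)
    show "finite (unmerged ` \<Z>)" using \<open>finite \<Z>\<close> by simp
    show "negligible S" if "S \<in> unmerged ` \<Z>" for S
    proof -
      obtain Z' where Z': "S = unmerged Z'" "admissible Z'" "card Z < card Z'" using \<open>S \<in> unmerged ` \<Z>\<close> by (auto simp: \<Z>_def)
      have "card Z' \<le> card D" using admissible_subset[OF Z'(2)] finite_D by (rule card_mono[rotated])
      then show ?thesis using less.hyps[OF _ Z'(2)] Z' by simp
    qed
  qed
  have 2: "negligible Q" unfolding Q_def by (rule almost_all_infinitely_often_wide[OF finZ Z01])
  have 3: "negligible (- regular)" using countable_not_regular
    by (simp add: negligible_iff_null_sets countable_imp_null_set_lborel null_sets_completionI)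
  define P where "P = unmerged Z - (\<Union>Z'\<in>\<Z>. unmerged Z') - Q - (- regular)"
  have "negligible P"
  proof (rule sigma_porous_negligible)
    fix \<alpha> assume \<alpha>: "\<alpha> \<in> P"
    have reg: "\<alpha> \<in> regular" and un: "\<alpha> \<in> unmerged Z" using \<alpha> by (auto simp: P_def)
    have "\<forall>z\<in>Z. \<forall>j. \<not> hits \<alpha> z j" using reg admissible_subset[OF less.prems] by (auto simp: regular_def)
    then obtain \<eta> where "\<eta> > 0" "infinite {n. wide Z \<eta> \<alpha> n}" using \<alpha> by (auto simp: P_def Q_def)
    then obtain \<kappa> where "\<kappa> > 0" "porous_at (unmerged Z) \<kappa> \<alpha>"
      using unmerged_porous_at[OF less.prems reg un] \<alpha> by (auto simp: P_def \<Z>_def)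
    then show "\<exists>\<kappa>>0. porous_at P \<kappa> \<alpha>"
      using porous_at_mono[of "unmerged Z" \<kappa> \<alpha> P \<kappa>] by (auto simp: P_def)
  qed
  then have "negligible (P \<union> (\<Union>Z'\<in>\<Z>. unmerged Z') \<union> Q \<union> (- regular))"
    using 1 2 3 by (intro negligible_Un)
  then show ?case by (rule negligible_subset) (auto simp: P_def)
qed

corollary endpoints_merge_almost_everywhere:
  "negligible {\<alpha>. \<forall>n. (T \<alpha> ^^ n) 0 \<noteq> (T \<alpha> ^^ n) 1}"
proof -
  have "admissible {0, 1}" using D_0 D_1 D_uminus[OF D_1] by (auto simp: admissible_def)
  then have "negligible (unmerged {0, 1})" by (rule unmerged_negligible)
  then show ?thesis by (rule negligible_subset) (auto simp: unmerged_def)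
qed

end

section \<open>Matching makes the mean locally linear\<close>

lemma integral_monomial_below:
  fixes t :: real
  assumes "0 \<le> t" "t \<le> 1"
  shows "has_bochner_integral lebesgue (\<lambda>y. indicator {0..1} y * (y ^ k * of_bool (y < t))) (t ^ Suc k / Suc k)"
proof -
  have p: "has_bochner_integral lborel (\<lambda>y. y ^ k * indicator {0..t} y) (t ^ Suc k / Suc k)"
    using borel_integrable_atLeastAtMost[of 0 t "\<lambda>y. y ^ k"] integral_power[OF assms(1), of k]
    by (simp add: has_bochner_integral_iff)
  have m: "(\<lambda>y :: real. indicator {0..1} y * (y ^ k * of_bool (y < t))) \<in> borel_measurable lborel"
    by measurable
  have "has_bochner_integral lborel (\<lambda>y. indicator {0..1} y * (y ^ k * of_bool (y < t))) (t ^ Suc k / Suc k)"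
  proof (rule has_bochner_integralI_AE[OF p m])
    show "AE y in lborel. y ^ k * indicator {0..t} y = indicator {0..1} y * (y ^ k * of_bool (y < t))"
      using AE_lborel_singleton[of t] by eventually_elim (use assms in \<open>auto simp: indicator_def\<close>)
  qed
  then show ?thesis using m by (simp add: has_bochner_integral_iff integrable_completion integral_completion)
qed

context expanding_beta
begin

lemma g_tilde_after_matching:
  assumes "(T \<alpha> ^^ N) 0 = (T \<alpha> ^^ N) 1"
  shows "g_tilde \<beta> \<alpha> x =
    (\<Sum>n<N. (of_bool (x < (T \<alpha> ^^ n) 1) - of_bool (x < (T \<alpha> ^^ n) 0)) / \<beta> ^ n)"
proof -
  have "summable (\<lambda>n. norm (1 / \<beta> ^ n))"
    using beta summable_geometric[of "1 / \<beta>"] by (simp add: power_one_over)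
  then have "(\<lambda>n. 1 / \<beta> ^ n) summable_on UNIV" by (rule norm_summable_imp_summable_on)
  then have s: "(\<lambda>n. 1 / \<beta> ^ n) summable_on A" for A by (rule summable_on_subset_banach) simp
  have split: "(\<Sum>\<^sub>\<infinity>n\<in>{n. x < (T \<alpha> ^^ n) y}. 1 / \<beta> ^ n) =
      (\<Sum>n<N. of_bool (x < (T \<alpha> ^^ n) y) / \<beta> ^ n) +
      (\<Sum>\<^sub>\<infinity>n\<in>{n. N \<le> n \<and> x < (T \<alpha> ^^ n) y}. 1 / \<beta> ^ n)" for y
  proof -
    have "{n. x < (T \<alpha> ^^ n) y} = {n. n < N \<and> x < (T \<alpha> ^^ n) y} \<union> {n. N \<le> n \<and> x < (T \<alpha> ^^ n) y}"
      by auto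
    then have "(\<Sum>\<^sub>\<infinity>n\<in>{n. x < (T \<alpha> ^^ n) y}. 1 / \<beta> ^ n) =
        (\<Sum>\<^sub>\<infinity>n\<in>{n. n < N \<and> x < (T \<alpha> ^^ n) y}. 1 / \<beta> ^ n) +
        (\<Sum>\<^sub>\<infinity>n\<in>{n. N \<le> n \<and> x < (T \<alpha> ^^ n) y}. 1 / \<beta> ^ n)"
      by (simp only:) (intro infsum_Un_disjoint s, auto)
    also have "(\<Sum>\<^sub>\<infinity>n\<in>{n. n < N \<and> x < (T \<alpha> ^^ n) y}. 1 / \<beta> ^ n) =
        (\<Sum>n | n < N \<and> x < (T \<alpha> ^^ n) y. 1 / \<beta> ^ n)"
      by (intro infsum_finite) auto
    also have "\<dots> = (\<Sum>n<N. of_bool (x < (T \<alpha> ^^ n) y) / \<beta> ^ n)"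
      by (intro sum.mono_neutral_cong_left) auto
    finally show ?thesis .
  qed
  have "{n. N \<le> n \<and> x < (T \<alpha> ^^ n) 0} = {n. N \<le> n \<and> x < (T \<alpha> ^^ n) 1}"
    using orbit_merge[OF assms] by auto
  then show ?thesis
    unfolding g_tilde_def split by (simp add: sum_subtractf diff_divide_distrib)
qed

text \<open>Only the moments with \<open>k = 0\<close> and \<open>k = 1\<close> are needed, for the normalisation and for the mean.\<close>

lemma g_tilde_moment:
  assumes "(T \<alpha> ^^ N) 0 = (T \<alpha> ^^ N) 1"
  shows "(LINT y:{0..1}|lebesgue. y ^ k * g_tilde \<beta> \<alpha> y) =
    (\<Sum>n<N. (((T \<alpha> ^^ n) 1) ^ Suc k - ((T \<alpha> ^^ n) 0) ^ Suc k) / \<beta> ^ n) / Suc k"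
proof -
  let ?F = "\<lambda>t y :: real. indicator {0..1} y * (y ^ k * of_bool (y < t)) :: real"
  have "has_bochner_integral lebesgue
     (\<lambda>y. \<Sum>n<N. (?F ((T \<alpha> ^^ n) 1) y - ?F ((T \<alpha> ^^ n) 0) y) / \<beta> ^ n)
     (\<Sum>n<N. (((T \<alpha> ^^ n) 1) ^ Suc k / Suc k - ((T \<alpha> ^^ n) 0) ^ Suc k / Suc k) / \<beta> ^ n)"
    by (intro has_bochner_integral_sum has_bochner_integral_divide_zero has_bochner_integral_diff
        integral_monomial_below orbit_range) auto
  moreover have "(\<lambda>y. \<Sum>n<N. (?F ((T \<alpha> ^^ n) 1) y - ?F ((T \<alpha> ^^ n) 0) y) / \<beta> ^ n) =
      (\<lambda>y. indicator {0..1} y *\<^sub>R (y ^ k * g_tilde \<beta> \<alpha> y))"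
    unfolding g_tilde_after_matching[OF assms]
    by (simp add: sum_distrib_left right_diff_distrib mult.assoc)
  moreover have "(\<Sum>n<N. (((T \<alpha> ^^ n) 1) ^ Suc k / Suc k - ((T \<alpha> ^^ n) 0) ^ Suc k / Suc k) / \<beta> ^ n) =
      (\<Sum>n<N. (((T \<alpha> ^^ n) 1) ^ Suc k - ((T \<alpha> ^^ n) 0) ^ Suc k) / \<beta> ^ n) / Suc k"
    unfolding sum_divide_distrib by (intro sum.cong refl) (simp add: diff_divide_distrib mult.commute)
  ultimately show ?thesis
    unfolding set_lebesgue_integral_def by (simp only: has_bochner_integral_iff)
qed

lemma M_fun_after_matching:
  assumes "(T \<alpha> ^^ N) 0 = (T \<alpha> ^^ N) 1"
  shows "M_fun \<beta> \<alpha> = (\<Sum>n<N. (((T \<alpha> ^^ n) 1)\<^sup>2 - ((T \<alpha> ^^ n) 0)\<^sup>2) / \<beta> ^ n) / 2 /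
    (\<Sum>n<N. ((T \<alpha> ^^ n) 1 - (T \<alpha> ^^ n) 0) / \<beta> ^ n)"
proof -
  have "M_fun \<beta> \<alpha> = (LINT y:{0..1}|lebesgue. y * g_tilde \<beta> \<alpha> y) / (LINT y:{0..1}|lebesgue. g_tilde \<beta> \<alpha> y)"
    unfolding M_fun_def g_dens_def times_divide_eq_right by (rule set_integral_divide_zero)
  moreover have "(LINT y:{0..1}|lebesgue. g_tilde \<beta> \<alpha> y) =
      (\<Sum>n<N. ((T \<alpha> ^^ n) 1 - (T \<alpha> ^^ n) 0) / \<beta> ^ n)"
    using g_tilde_moment[OF assms, of 0] by simp
  moreover have "(LINT y:{0..1}|lebesgue. y * g_tilde \<beta> \<alpha> y) =
      (\<Sum>n<N. (((T \<alpha> ^^ n) 1)\<^sup>2 - ((T \<alpha> ^^ n) 0)\<^sup>2) / \<beta> ^ n) / 2"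
    using g_tilde_moment[OF assms, of 1] by (simp add: power2_eq_square)
  ultimately show ?thesis by (simp only:)
qed

lemma orbit_affine_near_parameter:
  assumes "\<And>j. j < n \<Longrightarrow> \<not> hits \<alpha>\<^sub>0 x j"
  shows "\<exists>r>0. \<forall>\<alpha>. \<bar>\<alpha> - \<alpha>\<^sub>0\<bar> < r \<longrightarrow>
    (\<forall>j\<le>n. (T \<alpha> ^^ j) x = (T \<alpha>\<^sub>0 ^^ j) x + slope j * (\<alpha> - \<alpha>\<^sub>0))"
proof -
  obtain r where r: "r > 0" "\<And>\<alpha> y j. \<bar>\<alpha> - \<alpha>\<^sub>0\<bar> < r \<Longrightarrow> \<bar>y - x\<bar> < r \<Longrightarrow> j \<le> n \<Longrightarrow>
      (T \<alpha> ^^ j) y = (T \<alpha>\<^sub>0 ^^ j) x + \<beta> ^ j * (y - x) + slope j * (\<alpha> - \<alpha>\<^sub>0)"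
    using orbit_affine_near[OF assms] by blast
  show ?thesis
  proof (intro exI conjI allI impI, rule r(1))
    fix \<alpha> j assume "\<bar>\<alpha> - \<alpha>\<^sub>0\<bar> < r" "j \<le> n"
    then show "(T \<alpha> ^^ j) x = (T \<alpha>\<^sub>0 ^^ j) x + slope j * (\<alpha> - \<alpha>\<^sub>0)"
      using r(2)[of \<alpha> x j] r(1) by simp
  qed
qed

text \<open>The differences \<open>d n\<close> do not depend on the parameter near \<open>\<alpha>\<^sub>0\<close>, so in the quotient for the mean the
  denominator is constant and the squares contribute \<open>d n\<close> times an affine function. If the
  denominator vanishes, both sides are zero by the convention for division.\<close>

theorem matching_imp_locally_linear:
  assumes \<alpha>: "\<alpha>\<^sub>0 \<in> {0<..<1}" and nh: "\<And>j. \<not> hits \<alpha>\<^sub>0 0 j" "\<And>j. \<not> hits \<alpha>\<^sub>0 1 j"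
    and N: "(T \<alpha>\<^sub>0 ^^ N) 0 = (T \<alpha>\<^sub>0 ^^ N) 1"
  shows "locally_linear_at (M_fun \<beta>) \<alpha>\<^sub>0"
proof -
  obtain r0 where r0: "r0 > 0" "\<And>\<alpha> j. \<bar>\<alpha> - \<alpha>\<^sub>0\<bar> < r0 \<Longrightarrow> j \<le> N \<Longrightarrow>
      (T \<alpha> ^^ j) 0 = (T \<alpha>\<^sub>0 ^^ j) 0 + slope j * (\<alpha> - \<alpha>\<^sub>0)"
    using orbit_affine_near_parameter[of N \<alpha>\<^sub>0 0] nh(1) by blast
  obtain r1 where r1: "r1 > 0" "\<And>\<alpha> j. \<bar>\<alpha> - \<alpha>\<^sub>0\<bar> < r1 \<Longrightarrow> j \<le> N \<Longrightarrow>
      (T \<alpha> ^^ j) 1 = (T \<alpha>\<^sub>0 ^^ j) 1 + slope j * (\<alpha> - \<alpha>\<^sub>0)"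
    using orbit_affine_near_parameter[of N \<alpha>\<^sub>0 1] nh(2) by blast
  define r where "r = min (min r0 r1) (min \<alpha>\<^sub>0 (1 - \<alpha>\<^sub>0))"
  have r: "r > 0" "r \<le> r0" "r \<le> r1" "r \<le> \<alpha>\<^sub>0" "r \<le> 1 - \<alpha>\<^sub>0" using r0(1) r1(1) \<alpha> by (auto simp: r_def)
  define d where "d n = (T \<alpha>\<^sub>0 ^^ n) 1 - (T \<alpha>\<^sub>0 ^^ n) 0" for n
  define p where "p n = (T \<alpha>\<^sub>0 ^^ n) 1 + (T \<alpha>\<^sub>0 ^^ n) 0" for n
  define C where "C = (\<Sum>n<N. d n / \<beta> ^ n)"
  define A where "A = (\<Sum>n<N. d n * slope n / \<beta> ^ n)"
  define B where "B = (\<Sum>n<N. d n * p n / \<beta> ^ n)"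
  have "M_fun \<beta> \<alpha> = A / C * \<alpha> + (B / 2 - A * \<alpha>\<^sub>0) / C" if "\<alpha> \<in> {\<alpha>\<^sub>0 - r<..<\<alpha>\<^sub>0 + r}" for \<alpha>
  proof -
    have "\<bar>\<alpha> - \<alpha>\<^sub>0\<bar> < r" using that by auto
    then have o: "(T \<alpha> ^^ j) 0 = (T \<alpha>\<^sub>0 ^^ j) 0 + slope j * (\<alpha> - \<alpha>\<^sub>0)"
      "(T \<alpha> ^^ j) 1 = (T \<alpha>\<^sub>0 ^^ j) 1 + slope j * (\<alpha> - \<alpha>\<^sub>0)" if "j \<le> N" for j
      using r0(2)[of \<alpha> j] r1(2)[of \<alpha> j] r that by auto
    have "(T \<alpha> ^^ N) 0 = (T \<alpha> ^^ N) 1" using o[of N] N by simp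
    note M = M_fun_after_matching[OF this]
    have "(\<Sum>n<N. ((T \<alpha> ^^ n) 1 - (T \<alpha> ^^ n) 0) / \<beta> ^ n) = C"
      unfolding C_def by (intro sum.cong refl) (simp add: o d_def)
    moreover have "(\<Sum>n<N. (((T \<alpha> ^^ n) 1)\<^sup>2 - ((T \<alpha> ^^ n) 0)\<^sup>2) / \<beta> ^ n) = B + 2 * (\<alpha> - \<alpha>\<^sub>0) * A"
    proof -
      have "(((T \<alpha> ^^ n) 1)\<^sup>2 - ((T \<alpha> ^^ n) 0)\<^sup>2) / \<beta> ^ n =
          d n * p n / \<beta> ^ n + 2 * (\<alpha> - \<alpha>\<^sub>0) * (d n * slope n / \<beta> ^ n)" if "n < N" for n
      proof -
        have "((T \<alpha> ^^ n) 1)\<^sup>2 - ((T \<alpha> ^^ n) 0)\<^sup>2 = d n * p n + 2 * (\<alpha> - \<alpha>\<^sub>0) * (d n * slope n)"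
          using that by (simp add: o d_def p_def power2_eq_square algebra_simps)
        then show ?thesis by (simp add: add_divide_distrib)
      qed
      then show ?thesis unfolding A_def B_def by (simp add: sum.distrib sum_distrib_left)
    qed
    ultimately have "M_fun \<beta> \<alpha> = (B + 2 * (\<alpha> - \<alpha>\<^sub>0) * A) / 2 / C" using M by (simp only:)
    also have "(B + 2 * (\<alpha> - \<alpha>\<^sub>0) * A) / 2 = A * \<alpha> + (B / 2 - A * \<alpha>\<^sub>0)" by (simp add: field_simps)
    finally show ?thesis by (simp add: add_divide_distrib)
  qed
  moreover have "\<alpha>\<^sub>0 \<in> {\<alpha>\<^sub>0 - r<..<\<alpha>\<^sub>0 + r}" "{\<alpha>\<^sub>0 - r<..<\<alpha>\<^sub>0 + r} \<subseteq> {0..<1}" using r by auto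
  ultimately show ?thesis unfolding locally_linear_at_def by blast
qed

end

theorem (in finite_differences) locally_linear_almost_everywhere:
  "negligible {\<alpha>\<in>{0<..<1}. \<not> locally_linear_at (M_fun \<beta>) \<alpha>}"
proof -
  let ?N = "{\<alpha>. \<forall>n. (T \<alpha> ^^ n) 0 \<noteq> (T \<alpha> ^^ n) 1}"
  have "negligible (- regular)" using countable_not_regular
    by (simp add: negligible_iff_null_sets countable_imp_null_set_lborel null_sets_completionI)
  then have "negligible (?N \<union> - regular)"
    using endpoints_merge_almost_everywhere by (intro negligible_Un)
  moreover have "{\<alpha>\<in>{0<..<1}. \<not> locally_linear_at (M_fun \<beta>) \<alpha>} \<subseteq> ?N \<union> - regular"
  proof
    fix \<alpha> assume a: "\<alpha> \<in> {\<alpha>\<in>{0<..<1}. \<not> locally_linear_at (M_fun \<beta>) \<alpha>}"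
    show "\<alpha> \<in> ?N \<union> - regular"
    proof (rule ccontr)
      assume "\<alpha> \<notin> ?N \<union> - regular"
      then obtain N where "(T \<alpha> ^^ N) 0 = (T \<alpha> ^^ N) 1" and reg: "\<alpha> \<in> regular" by auto
      then show False
        using matching_imp_locally_linear[of \<alpha> N] a D_0 D_1 by (auto simp: regular_def)
    qed
  qed
  ultimately show ?thesis by (rule negligible_subset)
qed

section \<open>Multinacci numbers\<close>

locale multinacci =
  fixes q m :: nat and \<beta> :: real
  assumes q: "1 \<le> q" and \<beta>_gt: "real q < \<beta>" and \<beta>_eq: "\<beta> ^ m = (\<Sum>i<m. real q * \<beta> ^ i)"
begin

definition digit_sum :: "nat set \<Rightarrow> real" where
  "digit_sum A = (\<Sum>i\<in>A. real q / \<beta> ^ Suc i)"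

text \<open>The set is symmetric so that it contains the differences of orbits in either order.\<close>

definition differences :: "real set" where
  "differences = digit_sum ` Pow {..<m} \<union> (\<lambda>A. - digit_sum A) ` Pow {..<m}"

lemma beta_gt_1: "1 < \<beta>" using q \<beta>_gt by linarith

lemma digit_sum_nonneg: "0 \<le> digit_sum A"
  using beta_gt_1 by (auto simp: digit_sum_def intro!: sum_nonneg)

lemma digit_sum_full: "digit_sum {..<m} = 1"
proof -
  have "\<beta> ^ m * digit_sum {..<m} = (\<Sum>i<m. real q * \<beta> ^ (m - Suc i))"
    unfolding digit_sum_def sum_distrib_left using beta_gt_1
    by (intro sum.cong refl) (auto simp: power_diff field_simps)
  also have "\<dots> = (\<Sum>i<m. real q * \<beta> ^ i)" by (rule sum.nat_diff_reindex)
  also have "\<dots> = \<beta> ^ m" using \<beta>_eq by simp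
  finally show ?thesis using beta_gt_1 by simp
qed

lemma digit_sum_complement: "A \<subseteq> {..<m} \<Longrightarrow> digit_sum ({..<m} - A) = 1 - digit_sum A"
  using digit_sum_full sum_diff[of "{..<m}" A "\<lambda>i. real q / \<beta> ^ Suc i"] by (simp add: digit_sum_def)

lemma digit_sum_less_1: "A \<subset> {..<m} \<Longrightarrow> digit_sum A < 1"
  using digit_sum_full sum_strict_mono2[of "{..<m}" A _ "\<lambda>i. real q / \<beta> ^ Suc i"] q beta_gt_1
  by (smt (verit) DiffI digit_sum_def divide_nonneg_pos divide_pos_pos finite_lessThan of_nat_0_le_iff
      of_nat_0_less_iff psubset_imp_ex_mem psubset_imp_subset zero_less_power less_le_trans zero_less_one less_one not_le)

text \<open>Multiplication by \<open>\<beta>\<close> shifts the digits; the leading digit turns into the integer \<open>q\<close>.\<close>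

lemma digit_sum_shift:
  assumes "A \<subseteq> {..<m}"
  obtains A' where "A' \<subset> {..<m}" "\<beta> * digit_sum A = real (if 0 \<in> A then q else 0) + digit_sum A'"
proof -
  have m: "m \<noteq> 0" using \<beta>_eq by (cases m) auto
  have fin: "finite A" using assms finite_subset by blast
  define A' where "A' = {i. Suc i \<in> A}"
  have "A' \<subseteq> {..<m - 1}" using assms by (auto simp: A'_def)
  then have "A' \<subset> {..<m}" using m by (auto simp: psubset_eq)
  moreover have "\<beta> * digit_sum A = real (if 0 \<in> A then q else 0) + digit_sum A'"
  proof -
    define B where "B = (if 0 \<in> A then {0 :: nat} else {})"
    have "A = B \<union> Suc ` A'"
    proof (rule set_eqI)
      show "i \<in> A \<longleftrightarrow> i \<in> B \<union> Suc ` A'" for i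
        by (cases i) (auto simp: A'_def B_def)
    qed
    have "\<beta> * digit_sum A = (\<Sum>i\<in>A. real q / \<beta> ^ i)"
      unfolding digit_sum_def sum_distrib_left using beta_gt_1 by (intro sum.cong) auto
    also have "\<dots> = (\<Sum>i\<in>B \<union> Suc ` A'. real q / \<beta> ^ i)"
      using \<open>A = B \<union> Suc ` A'\<close> by simp
    also have "\<dots> = (\<Sum>i\<in>B. real q / \<beta> ^ i) + (\<Sum>i\<in>Suc ` A'. real q / \<beta> ^ i)"
    proof (rule sum.union_disjoint)
      have "Suc ` A' \<subseteq> A" by (auto simp: A'_def)
      then show "finite (Suc ` A')" using fin by (rule finite_subset)
    qed (auto simp: B_def)
    also have "(\<Sum>i\<in>Suc ` A'. real q / \<beta> ^ i) = digit_sum A'" by (simp add: digit_sum_def sum.reindex)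
    also have "(\<Sum>i\<in>B. real q / \<beta> ^ i) = real (if 0 \<in> A then q else 0)" by (simp add: B_def)
    finally show ?thesis .
  qed
  ultimately show thesis using that by blast
qed

text \<open>Modulo integers, the shift of a digit sum is a digit sum in \<open>[0, 1)\<close>. Its only other representative
  in \<open>(-1, 1)\<close> is smaller by one, which is the negative of the digit sum of the complement.\<close>

lemma digit_sum_step:
  assumes "A \<subseteq> {..<m}" "\<bar>\<beta> * digit_sum A - of_int k\<bar> < 1"
  shows "\<beta> * digit_sum A - of_int k \<in> differences"
proof -
  obtain A' where A': "A' \<subset> {..<m}" "\<beta> * digit_sum A = real (if 0 \<in> A then q else 0) + digit_sum A'"
    using digit_sum_shift[OF assms(1)] .
  define l where "l = k - int (if 0 \<in> A then q else 0)"
  have e: "\<beta> * digit_sum A - of_int k = digit_sum A' - of_int l" by (simp add: A'(2) l_def)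
  have "0 \<le> digit_sum A'" "digit_sum A' < 1" using digit_sum_nonneg digit_sum_less_1[OF A'(1)] by auto
  then have "- 1 < real_of_int l" "real_of_int l < 2" using assms(2) unfolding e by linarith+
  then consider "l = 0" | "l = 1" by linarith
  then show ?thesis
  proof cases
    case 1
    then show ?thesis using A'(1) unfolding e differences_def by auto
  next
    case 2
    then have "digit_sum A' - of_int l = - digit_sum ({..<m} - A')" using digit_sum_complement[of A'] A'(1) by auto
    then show ?thesis unfolding e differences_def by auto
  qed
qed

sublocale finite_differences \<beta> differences
proof
  show "1 < \<beta>" by (rule beta_gt_1)
  show "finite differences" by (simp add: differences_def)
  have "digit_sum {} = 0" by (simp add: digit_sum_def)
  then show "0 \<in> differences" unfolding differences_def by (metis UnI1 Pow_bottom imageI)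
  show "1 \<in> differences" unfolding differences_def using digit_sum_full by (metis UnI1 Pow_top imageI)
  show uminus: "- d \<in> differences" if "d \<in> differences" for d
    using that unfolding differences_def by auto
  show "\<beta> * d - k \<in> differences" if d: "d \<in> differences" "\<bar>\<beta> * d - k\<bar> < 1" for d and k :: int
  proof -
    obtain A where A: "A \<subseteq> {..<m}" and "d = digit_sum A \<or> d = - digit_sum A" using d(1) by (auto simp: differences_def)
    then consider "d = digit_sum A" | "d = - digit_sum A" by blast
    then show ?thesis
    proof cases
      case 1
      then show ?thesis using digit_sum_step[OF A, of k] d(2) by simp
    next
      case 2
      then have "\<beta> * d - k = - (\<beta> * digit_sum A - of_int (- k))" by simp
      then show ?thesis using digit_sum_step[OF A, of "- k"] d(2) uminus by (metis abs_minus_cancel)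
    qed
  qed
qed

end

theorem theorem4p1:
  fixes q m :: nat
  assumes "m \<ge> 2" and "q \<ge> 1"
  shows "AE \<alpha> in lebesgue. \<alpha> \<in> {1 - frac (beta_qm q m)..<1} \<longrightarrow>
           locally_linear_at (M_fun (beta_qm q m)) \<alpha>"
proof -
  define \<beta> where "\<beta> = beta_qm q m"
  have "\<beta> \<in> {real q<..<real q + 1} \<and> \<beta> ^ m = (\<Sum>i<m. real q * \<beta> ^ i)"
    unfolding \<beta>_def beta_qm_def using beta_qm_ex1[OF assms(2,1)] by (rule theI')
  then interpret multinacci q m \<beta> by unfold_locales (use assms in auto)
  have "AE \<alpha> in lebesgue. \<alpha> \<notin> {\<alpha>\<in>{0<..<1}. \<not> locally_linear_at (M_fun \<beta>) \<alpha>}"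
    using locally_linear_almost_everywhere by (intro AE_not_in) (simp add: negligible_iff_null_sets)
  then show ?thesis
    unfolding \<beta>_def[symmetric]
  proof eventually_elim
    case (elim \<alpha>)
    have "frac \<beta> < 1" by (rule frac_lt_1)
    then show ?case using elim by auto
  qed
qed

end
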